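(* Let the network $\mathcal{G}$ be strongly connected, let the local objective functions $f_1,\dots,f_n:\mathbb{R}^d\to\mathbb{R}$ be differentiable and convex with $f_i$ being $\beta_i$-smooth, let $F=\sum_{i=1}^n f_i$ be $\alpha_F$-strongly convex with minimizer $\mathbf{x}^*$, and let the algorithm described in the context be run with some $K\ge 1$ and $\eta$. Then the algorithm has $R$-linear convergence when the stepsize parameter $\lambda$ is sufficiently small. That is, there exists $\bar\lambda>0$ such that for every $\lambda\in(0,\bar\lambda)$ and every run of the algorithm with stepsize parameter $\lambda$ (i.e. every choice of initial points and of parameters admissible under the parameter design), there exist $c>0$ and $\rho\in(0,1)$ with $$\|\mathbf{x}^k-\mathbf{1}_n\otimes\mathbf{x}^*\|\le c\,\rho^k\qquad\text{for all } k\ge 0,$$ where $\mathbf{x}^k=[(\mathbf{x}_1^k)^T\cdots(\mathbf{x}_n^k)^T]^T$.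
   Context: Network: $\mathcal{G}=(\mathcal{V},\mathcal{E})$ is a directed graph with $\mathcal{V}=\{1,\dots,n\}$, $n\ge 2$, without self edges; $(i,j)\in\mathcal{E}$ means node $j$ can send messages to node $i$. $\mathcal{N}_i^{out}=\{j:(j,i)\in\mathcal{E}\}$ and $\mathcal{N}_i^{in}=\{j:(i,j)\in\mathcal{E}\}$. Functions: a differentiable $f$ is $\beta$-smooth ($\beta>0$) if $\|\nabla f(\mathbf{x})-\nabla f(\mathbf{x}')\|\le\beta\|\mathbf{x}-\mathbf{x}'\|$ for all $\mathbf{x},\mathbf{x}'$, and $\alpha$-strongly convex ($\alpha>0$) if $(\nabla f(\mathbf{x})-\nabla f(\mathbf{x}'))^T(\mathbf{x}-\mathbf{x}')\ge\alpha\|\mathbf{x}-\mathbf{x}'\|^2$ for all $\mathbf{x},\mathbf{x}'$. $\|\cdot\|$ is the Euclidean norm, $\mathbf{1}_n$ the all-ones vector, $\otimes$ the Kronecker product. Algorithm: each node $i$ picks $\mathbf{x}_i^0\in\mathbb{R}^d$ arbitrarily and sets $\mathbf{y}_i^0=\nabla f_i(\mathbf{x}_i^0)$. For $k\ge 0$, $$\mathbf{x}_i^{k+1}=\sum_{j\in\mathcal{N}_i^{in}\cup\{i\}}\big(\mathbf{R}_{ij}^k\mathbf{x}_j^k-\mathbf{A}_{ij}^k\mathbf{\Lambda}_j^k\mathbf{y}_j^k\big),\qquad \mathbf{y}_i^{k+1}=\sum_{j\in\mathcal{N}_i^{in}\cup\{i\}}\big(\mathbf{C}_{ij}^k\mathbf{y}_j^k+\mathbf{B}_{ij}^k(\nabla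 f_j(\mathbf{x}_j^{k+1})-\nabla f_j(\mathbf{x}_j^k))\big).$$ Parameter design (with a positive integer $K$, a constant $\eta\in(0,1)$ small enough that the choices below are feasible, and a stepsize parameter $\lambda>0$): (i) For $k<K$: $\mathbf{\Lambda}_i^k$, $\mathbf{R}_{ij}^k,\mathbf{A}_{ij}^k$ (for $j\in\mathcal{N}_i^{in}\cup\{i\}$) and $\mathbf{C}_{ji}^k,\mathbf{B}_{ji}^k$ (for $j\in\mathcal{N}_i^{out}$) are $d\times d$ diagonal matrices whose diagonal entries are drawn from distributions with support $\mathbb{R}$, so they may be any real numbers; and $\mathbf{C}_{ii}^k=\mathbf{I}_d-\sum_{j\in\mathcal{N}_i^{out}}\mathbf{C}_{ji}^k$, $\mathbf{B}_{ii}^k=\mathbf{I}_d-\sum_{j\in\mathcal{N}_i^{out}}\mathbf{B}_{ji}^k$. (ii) For $k\ge K$: $\mathbf{\Lambda}_i^k=\lambda\mathbf{I}_d$; $\mathbf{R}_{ij}^k=r_{ij}^k\mathbf{I}_d$, $\mathbf{A}_{ij}^k=a_{ij}^k\mathbf{I}_d$ with $r_{ij}^k,a_{ij}^k\in[\eta,1]$ for $j\in\mathcal{N}_i^{in}\cup\{i\}$ and $0$ otherwise, $\sum_j r_{ij}^k=\sum_j a_{ij}^k=1$; $\mathbf{C}_{ji}^k=c_{ji}^k\mathbf{I}_d$, $\mathbf{B}_{ji}^k=b_{ji}^k\mathbf{I}_d$ with $c_{ji}^k,b_{ji}^k\in[\eta,1]$ for $j\in\mathcal{N}_i^{out}\cup\{i\}$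 and $0$ otherwise, $\sum_j c_{ji}^k=\sum_j b_{ji}^k=1$. *)

theory Defs
  imports "HOL-Analysis.Analysis"
begin

(* An edge (i, j) means that node j can send messages to node i. *)

definition in_nbrs :: "('n \<times> 'n) set \<Rightarrow> 'n \<Rightarrow> 'n set" where
  "in_nbrs E i = {j. (i, j) \<in> E}"

definition out_nbrs :: "('n \<times> 'n) set \<Rightarrow> 'n \<Rightarrow> 'n set" where
  "out_nbrs E i = {j. (j, i) \<in> E}"

definition strongly_connected :: "('n \<times> 'n) set \<Rightarrow> bool" where
  "strongly_connected E \<longleftrightarrow> (\<forall>i j. (i, j) \<in> E\<^sup>*)"

(* Meaningful only where f is differentiable; see GDERIV_gradient. *)
definition gradient :: "('a::euclidean_space \<Rightarrow> real) \<Rightarrow> 'a \<Rightarrow> 'a" where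
  "gradient f x = (THE D. GDERIV f x :> D)"

lemma GDERIV_gradient:
  fixes f :: "'a::euclidean_space \<Rightarrow> real"
  assumes "f differentiable (at x)"
  shows "GDERIV f x :> gradient f x"
proof -
  obtain f' where f': "(f has_derivative f') (at x)"
    using assms unfolding differentiable_def by blast
  then interpret bounded_linear f'
    by (rule has_derivative_bounded_linear)
  define D where "D = (\<Sum>b\<in>Basis. f' b *\<^sub>R b)"
  have "f' h = h \<bullet> D" for h
  proof -
    have "f' h = f' (\<Sum>b\<in>Basis. (h \<bullet> b) *\<^sub>R b)"
      by (simp add: euclidean_representation)
    also have "\<dots> = (\<Sum>b\<in>Basis. (h \<bullet> b) * f' b)"
      by (simp add: sum scaleR)
    also have "\<dots> = h \<bullet> D"
      by (simp add: D_def inner_sum_right mult.commute)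
    finally show ?thesis .
  qed
  then have "f' = (\<lambda>h. h \<bullet> D)"
    by (rule ext)
  with f' have D: "GDERIV f x :> D"
    by (simp add: gderiv_def)
  have "D' = D" if "GDERIV f x :> D'" for D'
  proof -
    have "(\<lambda>h. h \<bullet> D') = (\<lambda>h. h \<bullet> D)"
      using that D unfolding gderiv_def by (rule has_derivative_unique)
    then show ?thesis
      by (metis vector_eq_ldot)
  qed
  with D show ?thesis
    unfolding gradient_def by (rule theI)
qed

definition smooth :: "real \<Rightarrow> ('a::euclidean_space \<Rightarrow> real) \<Rightarrow> bool" where
  "smooth \<beta> f \<longleftrightarrow> \<beta> > 0 \<and> (\<forall>x. f differentiable (at x)) \<and>
     (\<forall>x x'. norm (gradient f x - gradient f x') \<le> \<beta> * norm (x - x'))"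

definition strongly_convex :: "real \<Rightarrow> ('a::euclidean_space \<Rightarrow> real) \<Rightarrow> bool" where
  "strongly_convex \<alpha> f \<longleftrightarrow> \<alpha> > 0 \<and> (\<forall>x. f differentiable (at x)) \<and>
     (\<forall>x x'. (gradient f x - gradient f x') \<bullet> (x - x') \<ge> \<alpha> * (norm (x - x'))\<^sup>2)"

definition diagonal :: "real^'d^'d \<Rightarrow> bool" where
  "diagonal M \<longleftrightarrow> (\<forall>p q. p \<noteq> q \<longrightarrow> M $ p $ q = 0)"

definition row_weights :: "('n::finite \<times> 'n) set \<Rightarrow> real \<Rightarrow> ('n \<Rightarrow> 'n \<Rightarrow> real) \<Rightarrow> bool" where
  "row_weights E \<eta> w \<longleftrightarrow>
     (\<forall>i. (\<forall>j \<in> in_nbrs E i \<union> {i}. w i j \<in> {\<eta>..1}) \<and>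
          (\<forall>j. j \<notin> in_nbrs E i \<union> {i} \<longrightarrow> w i j = 0) \<and>
          (\<Sum>j\<in>UNIV. w i j) = 1)"

definition column_weights :: "('n::finite \<times> 'n) set \<Rightarrow> real \<Rightarrow> ('n \<Rightarrow> 'n \<Rightarrow> real) \<Rightarrow> bool" where
  "column_weights E \<eta> w \<longleftrightarrow>
     (\<forall>i. (\<forall>j \<in> out_nbrs E i \<union> {i}. w j i \<in> {\<eta>..1}) \<and>
          (\<forall>j. j \<notin> out_nbrs E i \<union> {i} \<longrightarrow> w j i = 0) \<and>
          (\<Sum>j\<in>UNIV. w j i) = 1)"

(* The bound eta is small enough for the weights in the second phase to exist. *)
definition feasible :: "('n::finite \<times> 'n) set \<Rightarrow> real \<Rightarrow> bool" where
  "feasible E \<eta> \<longleftrightarrow> (\<exists>w. row_weights E \<eta> w) \<and> (\<exists>w. column_weights E \<eta> w)"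

(* Parameters of one iteration k < K.  The entries are drawn at random with full support;
   only their possible values matter here, and these are arbitrary.
   Matrices indexed by non-neighbours are left unconstrained: the algorithm never uses them. *)
definition admissible_initial ::
  "('n::finite \<times> 'n) set \<Rightarrow> ('n \<Rightarrow> real^'d^'d) \<Rightarrow> ('n \<Rightarrow> 'n \<Rightarrow> real^'d^'d) \<Rightarrow>
   ('n \<Rightarrow> 'n \<Rightarrow> real^'d^'d) \<Rightarrow> ('n \<Rightarrow> 'n \<Rightarrow> real^'d^'d) \<Rightarrow> ('n \<Rightarrow> 'n \<Rightarrow> real^'d^'d) \<Rightarrow> bool" where
  "admissible_initial E \<Lambda> R A C B \<longleftrightarrow>
     (\<forall>i. diagonal (\<Lambda> i) \<and>
          (\<forall>j \<in> in_nbrs E i \<union> {i}. diagonal (R i j) \<and> diagonal (A i j)) \<and>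
          (\<forall>j \<in> out_nbrs E i. diagonal (C j i) \<and> diagonal (B j i)) \<and>
          C i i = mat 1 - (\<Sum>j\<in>out_nbrs E i. C j i) \<and>
          B i i = mat 1 - (\<Sum>j\<in>out_nbrs E i. B j i))"

(* Parameters of one iteration k >= K, with stepsize parameter l. *)
definition admissible_final ::
  "('n::finite \<times> 'n) set \<Rightarrow> real \<Rightarrow> real \<Rightarrow> ('n \<Rightarrow> real^'d^'d) \<Rightarrow> ('n \<Rightarrow> 'n \<Rightarrow> real^'d^'d) \<Rightarrow>
   ('n \<Rightarrow> 'n \<Rightarrow> real^'d^'d) \<Rightarrow> ('n \<Rightarrow> 'n \<Rightarrow> real^'d^'d) \<Rightarrow> ('n \<Rightarrow> 'n \<Rightarrow> real^'d^'d) \<Rightarrow> bool" where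
  "admissible_final E \<eta> l \<Lambda> R A C B \<longleftrightarrow>
     (\<forall>i. \<Lambda> i = l *\<^sub>R mat 1) \<and>
     (\<exists>r. row_weights E \<eta> r \<and> (\<forall>i j. R i j = r i j *\<^sub>R mat 1)) \<and>
     (\<exists>a. row_weights E \<eta> a \<and> (\<forall>i j. A i j = a i j *\<^sub>R mat 1)) \<and>
     (\<exists>c. column_weights E \<eta> c \<and> (\<forall>i j. C i j = c i j *\<^sub>R mat 1)) \<and>
     (\<exists>b. column_weights E \<eta> b \<and> (\<forall>i j. B i j = b i j *\<^sub>R mat 1))"

definition admissible ::
  "('n::finite \<times> 'n) set \<Rightarrow> nat \<Rightarrow> real \<Rightarrow> real \<Rightarrow> (nat \<Rightarrow> 'n \<Rightarrow> real^'d^'d) \<Rightarrow>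
   (nat \<Rightarrow> 'n \<Rightarrow> 'n \<Rightarrow> real^'d^'d) \<Rightarrow> (nat \<Rightarrow> 'n \<Rightarrow> 'n \<Rightarrow> real^'d^'d) \<Rightarrow>
   (nat \<Rightarrow> 'n \<Rightarrow> 'n \<Rightarrow> real^'d^'d) \<Rightarrow> (nat \<Rightarrow> 'n \<Rightarrow> 'n \<Rightarrow> real^'d^'d) \<Rightarrow> bool" where
  "admissible E K \<eta> l \<Lambda> R A C B \<longleftrightarrow>
     (\<forall>k<K. admissible_initial E (\<Lambda> k) (R k) (A k) (C k) (B k)) \<and>
     (\<forall>k\<ge>K. admissible_final E \<eta> l (\<Lambda> k) (R k) (A k) (C k) (B k))"

(* x k and y k stack the nodes' vectors; the norm on real^'d^'n is the Euclidean norm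
   of the concatenation of all blocks.  The initial point x 0 is arbitrary. *)
definition is_run ::
  "('n::finite \<times> 'n) set \<Rightarrow> ('n \<Rightarrow> real^'d \<Rightarrow> real) \<Rightarrow> (nat \<Rightarrow> 'n \<Rightarrow> real^'d^'d) \<Rightarrow>
   (nat \<Rightarrow> 'n \<Rightarrow> 'n \<Rightarrow> real^'d^'d) \<Rightarrow> (nat \<Rightarrow> 'n \<Rightarrow> 'n \<Rightarrow> real^'d^'d) \<Rightarrow>
   (nat \<Rightarrow> 'n \<Rightarrow> 'n \<Rightarrow> real^'d^'d) \<Rightarrow> (nat \<Rightarrow> 'n \<Rightarrow> 'n \<Rightarrow> real^'d^'d) \<Rightarrow>
   (nat \<Rightarrow> real^'d^'n) \<Rightarrow> (nat \<Rightarrow> real^'d^'n) \<Rightarrow> bool" where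
  "is_run E f \<Lambda> R A C B x y \<longleftrightarrow>
     (\<forall>i. y 0 $ i = gradient (f i) (x 0 $ i)) \<and>
     (\<forall>k i. x (Suc k) $ i =
        (\<Sum>j\<in>in_nbrs E i \<union> {i}. R k i j *v (x k $ j) - A k i j *v (\<Lambda> k j *v (y k $ j)))) \<and>
     (\<forall>k i. y (Suc k) $ i =
        (\<Sum>j\<in>in_nbrs E i \<union> {i}. C k i j *v (y k $ j) +
           B k i j *v (gradient (f j) (x (Suc k) $ j) - gradient (f j) (x k $ j))))"

end

theory Submission
  imports Defs
begin

text \<open>
  After the first phase all weights are scalar, \<open>r\<close> and \<open>a\<close> are row stochastic, \<open>c\<close> and \<open>b\<close> are
  column stochastic, and every link of the graph, self loops included, carries weight at least
  \<open>\<eta>\<close>. All that survives of the first phase is that the sum of the \<open>y\<^sub>i\<close> equals the sum of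
  the local gradients: both phases preserve this identity, because the columns of \<open>C\<close> and \<open>B\<close>
  sum to the identity matrix. What happens in finitely many steps only affects the constant in
  the rate, so it is enough to study the second phase.

  Strong connectivity yields a number \<open>T\<close> such that any product of \<open>T\<close> consecutive weight
  matrices has all entries at least \<open>\<epsilon> = \<eta>^T\<close>. Three errors are followed: the largest distance
  \<open>D\<close> of a node from the minimizer; the spread \<open>S\<close>, the largest distance between two nodes; and
  the sum \<open>V\<close> of the norms of the residuals \<open>y\<^sub>i - \<pi>\<^sub>i g\<close>, where \<open>g\<close> is the sum of the local
  gradients and the probability vector \<open>\<pi>\<close> is transported by the matrices \<open>c\<close>.
  With stepsize \<open>l\<close>, smoothness \<open>L\<close> and strong convexity \<open>\<alpha>\<close> they satisfy, up to constants,

  \<^item> \<open>D(k+1) \<le> (1 - l \<epsilon> \<alpha> / 2) D(k) + l (L S(k) + V(k))\<close> (\<open>dist_Suc_le\<close>): each node moves to an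
    average \<open>z\<close> of nodes and then performs a gradient step for the sum of the objectives at \<open>z\<close>,
    of length between \<open>l \<epsilon>\<close> and \<open>l\<close>;
  \<^item> \<open>S(k+T) \<le> (1 - \<epsilon>) S(k) + T l (L D + V)\<close> (\<open>spread_after_T\<close>), as \<open>T\<close> averaging steps contract
    the spread;
  \<^item> \<open>V(k+T) \<le> (1 - \<epsilon>) V(k) + T L (S + l (L D + V))\<close> (\<open>resid_after_T\<close>), as the residuals sum to
    zero and \<open>T\<close> column stochastic steps contract such vectors in the sum norm,

  where errors without an argument are maxima over the \<open>T\<close> steps from \<open>k\<close> on. Spread and residual
  are thus of order \<open>l\<close> relative to \<open>D\<close>, whereas they disturb \<open>D\<close> only through a factor \<open>l\<close>,
  against a contraction gap of order \<open>l\<close>. Hence every feedback loop has gain of order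
  \<open>l\<close>, and for small \<open>l\<close> a strong induction gives \<open>D(k) \<le> m \<rho>^k\<close>, \<open>S(k) \<le> \<sigma> l m \<rho>^k\<close> and
  \<open>V(k) \<le> \<tau> l m \<rho>^k\<close> with \<open>\<rho> = 1 - l \<epsilon> \<alpha> / 4\<close> and constants \<open>\<sigma>\<close>, \<open>\<tau>\<close> that depend neither on
  the run nor on \<open>l\<close> (\<open>linear_convergence\<close>). Working with the largest distance \<open>D\<close>, rather than
  the distance of one weighted mean of the nodes, avoids the limits of backward products of row
  stochastic matrices that such a mean would require.
\<close>

section \<open>Averaging with time-varying stochastic weights\<close>

definition mix :: "('n::finite \<Rightarrow> 'n \<Rightarrow> real) \<Rightarrow> ('n \<Rightarrow> 'a::real_vector) \<Rightarrow> 'n \<Rightarrow> 'a" where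
  "mix w u i = (\<Sum>j\<in>UNIV. w i j *\<^sub>R u j)"

text \<open>
  The matrix product \<open>W (t - 1) \<cdots> W 1 W 0\<close>: later weights act from the left.
\<close>

primrec weight_product ::
  "(nat \<Rightarrow> 'n::finite \<Rightarrow> 'n \<Rightarrow> real) \<Rightarrow> nat \<Rightarrow> 'n \<Rightarrow> 'n \<Rightarrow> real" where
  "weight_product W 0 = (\<lambda>i j. of_bool (i = j))"
| "weight_product W (Suc t) = (\<lambda>i j. \<Sum>l\<in>UNIV. W t i l * weight_product W t l j)"

definition row_stochastic :: "('n::finite \<Rightarrow> 'n \<Rightarrow> real) \<Rightarrow> bool" where
  "row_stochastic w \<longleftrightarrow> (\<forall>i j. 0 \<le> w i j) \<and> (\<forall>i. (\<Sum>j\<in>UNIV. w i j) = 1)"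

definition column_stochastic :: "('n::finite \<Rightarrow> 'n \<Rightarrow> real) \<Rightarrow> bool" where
  "column_stochastic w \<longleftrightarrow> (\<forall>i j. 0 \<le> w i j) \<and> (\<forall>j. (\<Sum>i\<in>UNIV. w i j) = 1)"

lemma mix_diff: "mix w (\<lambda>j. u j - v j) i = mix w u i - mix w v i"
  by (simp add: mix_def scaleR_right_diff_distrib sum_subtractf)

lemma mix_add: "mix w (\<lambda>j. u j + v j) i = mix w u i + mix w v i"
  by (simp add: mix_def scaleR_right_distrib sum.distrib)

lemma mix_weight_product_0: "mix (weight_product W 0) u = u"
proof
  fix i
  have "mix (weight_product W 0) u i = (\<Sum>j\<in>UNIV. if i = j then u j else 0)"
    unfolding mix_def by (intro sum.cong) auto
  then show "mix (weight_product W 0) u i = u i" by simp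
qed

lemma mix_weight_product_Suc:
  "mix (weight_product W (Suc t)) u i = mix (W t) (mix (weight_product W t) u) i"
  unfolding mix_def weight_product.simps scaleR_sum_left scaleR_sum_right scaleR_scaleR
  by (rule sum.swap)

lemma iterated_mix:
  assumes "\<And>t i. u (Suc t) i = mix (W t) (u t) i"
  shows "u t i = mix (weight_product W t) (u 0) i"
proof (induction t arbitrary: i)
  case (Suc t)
  then have "u t = mix (weight_product W t) (u 0)" by blast
  then show ?case by (simp only: assms mix_weight_product_Suc)
qed (simp add: mix_weight_product_0 del: weight_product.simps)

lemma row_stochastic_weight_product:
  assumes "\<And>t. row_stochastic (W t)"
  shows "row_stochastic (weight_product W t)"
proof (induction t)
  case (Suc t)
  have "(\<Sum>j\<in>UNIV. \<Sum>l\<in>UNIV. W t i l * weight_product W t l j) = 1" for i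
    by (subst sum.swap)
      (use Suc assms[of t] in \<open>simp add: row_stochastic_def flip: sum_distrib_left\<close>)
  then show ?case using Suc assms[of t] 
    by (auto simp: row_stochastic_def intro!: sum_nonneg)
qed (simp add: row_stochastic_def)

lemma column_stochastic_weight_product:
  assumes "\<And>t. column_stochastic (W t)"
  shows "column_stochastic (weight_product W t)"
proof (induction t)
  case (Suc t)
  have "(\<Sum>i\<in>UNIV. \<Sum>l\<in>UNIV. W t i l * weight_product W t l j) = 1" for j
    by (subst sum.swap)
      (use Suc assms[of t] in \<open>simp add: column_stochastic_def flip: sum_distrib_right\<close>)
  then show ?case using Suc assms[of t] 
    by (auto simp: column_stochastic_def intro!: sum_nonneg)
qed (simp add: column_stochastic_def)

text \<open>
  The entry \<open>(i, j)\<close> of the product sums the weights of all walks of length \<open>t\<close> from \<open>i\<close> to \<open>j\<close>.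
  Already a single walk along strong links contributes \<open>\<eta> ^ t\<close>.
\<close>

lemma weight_product_walk_ge:
  assumes "0 \<le> \<eta>" and nonneg: "\<And>t i j. 0 \<le> W t i j"
    and links: "\<And>t i j. (i, j) \<in> S \<Longrightarrow> \<eta> \<le> W t i j"
  shows "(i, j) \<in> S ^^ t \<Longrightarrow> \<eta> ^ t \<le> weight_product W t i j"
proof (induction t arbitrary: i)
  case (Suc t)
  from Suc.prems obtain l where l: "(i, l) \<in> S" "(l, j) \<in> S ^^ t"
    by (rule relpow_E2) auto
  have pnn: "0 \<le> weight_product W t i j" for t i j
    by (induction t arbitrary: i) (auto intro!: sum_nonneg mult_nonneg_nonneg nonneg)
  have "\<eta> * \<eta> ^ t \<le> W t i l * weight_product W t l j"
    by (intro mult_mono links l Suc.IH nonneg) (use assms in auto)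
  also have "\<dots> \<le> (\<Sum>l\<in>UNIV. W t i l * weight_product W t l j)"
    by (rule member_le_sum) (auto intro: mult_nonneg_nonneg nonneg pnn)
  finally show ?case by simp
qed simp

text \<open>
  Idling on a self loop lengthens a walk, so walks between all pairs of nodes can be given one
  common length. The sum of the original lengths serves as a bound of each of them.
\<close>

lemma strongly_connected_uniform_walk_length:
  fixes E :: "('n::finite \<times> 'n) set"
  assumes "strongly_connected E"
  obtains T where "1 \<le> T" "\<And>i j. (i, j) \<in> (E \<union> Id) ^^ T"
proof -
  have "\<forall>p. \<exists>n. p \<in> E ^^ n"
    using assms by (metis strongly_connected_def rtrancl_power surj_pair)
  then obtain len where len: "\<And>p. p \<in> E ^^ len p" by metis
  define T where "T = Suc (\<Sum>p\<in>UNIV. len p)"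
  have "p \<in> (E \<union> Id) ^^ T" for p
  proof -
    have "len p \<le> (\<Sum>p\<in>UNIV. len p)" by (rule member_le_sum) auto
    then have T: "T = len p + (T - len p)" by (simp add: T_def)
    have pad: "(E \<union> Id) ^^ n \<subseteq> (E \<union> Id) ^^ (n + d)" for n d
      by (induction d) auto
    have "E ^^ n \<subseteq> (E \<union> Id) ^^ n" for n
      by (induction n) auto
    then have "p \<in> (E \<union> Id) ^^ len p" using len by blast
    then have "p \<in> (E \<union> Id) ^^ (len p + (T - len p))" using pad by (rule rev_subsetD)
    then show ?thesis unfolding T[symmetric] .
  qed
  then show thesis by (intro that[of T]) (auto simp: T_def)
qed

lemma norm_row_mix_diff_le:
  fixes u :: "'n::finite \<Rightarrow> 'a::real_normed_vector"
  assumes "row_stochastic w" "\<And>j. norm (u j - p) \<le> d"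
  shows "norm (mix w u i - p) \<le> d"
proof -
  have "mix w u i - p = (\<Sum>j\<in>UNIV. w i j *\<^sub>R (u j - p))"
    using assms(1)
    by (simp add: mix_def row_stochastic_def scaleR_right_diff_distrib sum_subtractf
        flip: scaleR_sum_left)
  also have "norm \<dots> \<le> (\<Sum>j\<in>UNIV. w i j * d)"
    using assms by (intro sum_norm_le) (auto simp: row_stochastic_def intro!: mult_left_mono)
  also have "\<dots> = d" using assms(1) by (simp add: row_stochastic_def flip: sum_distrib_right)
  finally show ?thesis .
qed

text \<open>
  Both averages are written over pairs: if \<open>P\<close> and \<open>Q\<close> are independent with distributions \<open>w i\<close> and
  \<open>w j\<close>, the difference is the expectation of \<open>u P - u Q\<close>. The pairs with \<open>P = Q\<close> contribute
  nothing and have total probability at least \<open>\<epsilon>\<close>.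
\<close>

lemma row_mix_spread_le:
  fixes u :: "'n::finite \<Rightarrow> 'a::real_normed_vector"
  assumes w: "row_stochastic w" and lower: "\<And>i j. \<epsilon> \<le> w i j"
    and spread: "\<And>i j. norm (u i - u j) \<le> d"
  shows "norm (mix w u i - mix w u j) \<le> (1 - \<epsilon>) * d"
proof -
  have nn: "0 \<le> w i j" and one: "(\<Sum>j\<in>UNIV. w i j) = 1" for i j
    using w by (auto simp: row_stochastic_def)
  have d: "0 \<le> d" using spread order_trans norm_ge_zero by blast
  have "mix w u i - mix w u j = (\<Sum>p\<in>UNIV. \<Sum>q\<in>UNIV. (w i p * w j q) *\<^sub>R (u p - u q))"
  proof -
    have "(\<Sum>p\<in>UNIV. \<Sum>q\<in>UNIV. (w i p * w j q) *\<^sub>R u p) = mix w u i"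
      by (simp add: mix_def one flip: scaleR_sum_left sum_distrib_left)
    moreover have "(\<Sum>p\<in>UNIV. \<Sum>q\<in>UNIV. (w i p * w j q) *\<^sub>R u q) = mix w u j"
      by (subst sum.swap) (simp add: mix_def one flip: scaleR_sum_left sum_distrib_right)
    ultimately show ?thesis by (simp add: scaleR_right_diff_distrib sum_subtractf)
  qed
  also have "norm \<dots> \<le> (\<Sum>p\<in>UNIV. \<Sum>q\<in>UNIV. (w i p * w j q) * (d - of_bool (p = q) * d))"
    using spread nn d by (intro sum_norm_le) (auto intro!: mult_left_mono)
  also have "\<dots> = (\<Sum>p\<in>UNIV. \<Sum>q\<in>UNIV. (w i p * w j q) * d)
      - (\<Sum>p\<in>UNIV. \<Sum>q\<in>UNIV. if p = q then w i p * w j p * d else 0)"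
    unfolding sum_subtractf[symmetric] by (intro sum.cong) auto
  also have "\<dots> = d - (\<Sum>p\<in>UNIV. w i p * w j p) * d"
    by (simp add: one flip: sum_distrib_left sum_distrib_right)
  also have "\<dots> \<le> d - \<epsilon> * d"
  proof -
    have "\<epsilon> = (\<Sum>p\<in>UNIV. \<epsilon> * w j p)" by (simp add: one flip: sum_distrib_left)
    also have "\<dots> \<le> (\<Sum>p\<in>UNIV. w i p * w j p)"
      by (intro sum_mono mult_right_mono lower nn)
    finally show ?thesis using d by (simp add: mult_right_mono)
  qed
  finally show ?thesis by (simp add: algebra_simps)
qed

lemma sum_column_mix:
  assumes "column_stochastic w"
  shows "(\<Sum>i\<in>UNIV. mix w u i) = (\<Sum>j\<in>UNIV. u j)"
  unfolding mix_def by (subst sum.swap)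
    (use assms in \<open>simp add: column_stochastic_def flip: scaleR_sum_left\<close>)

lemma column_mix_sum_norm_le:
  fixes u :: "'n::finite \<Rightarrow> 'a::real_normed_vector"
  assumes "column_stochastic w"
  shows "(\<Sum>i\<in>UNIV. norm (mix w u i)) \<le> (\<Sum>j\<in>UNIV. norm (u j))"
proof -
  have "norm (mix w u i) \<le> mix w (\<lambda>j. norm (u j)) i" for i
    using assms unfolding mix_def by (intro sum_norm_le) (auto simp: column_stochastic_def)
  then have "(\<Sum>i\<in>UNIV. norm (mix w u i)) \<le> (\<Sum>i\<in>UNIV. mix w (\<lambda>j. norm (u j)) i)"
    by (intro sum_mono)
  then show ?thesis by (simp add: sum_column_mix[OF assms])
qed

text \<open>
  For a vector that sums to zero, \<open>\<epsilon>\<close> can be subtracted from every weight without changing the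
  result. The remaining weights are nonnegative with column sums at most \<open>1 - \<epsilon>\<close>.
\<close>

lemma column_mix_sum_norm_contraction:
  fixes u :: "'n::finite \<Rightarrow> 'a::real_normed_vector"
  assumes w: "column_stochastic w" and lower: "\<And>i j. \<epsilon> \<le> w i j" and "0 \<le> \<epsilon>"
    and zero: "(\<Sum>j\<in>UNIV. u j) = 0"
  shows "(\<Sum>i\<in>UNIV. norm (mix w u i)) \<le> (1 - \<epsilon>) * (\<Sum>j\<in>UNIV. norm (u j))"
proof -
  have "mix w u i = (\<Sum>j\<in>UNIV. (w i j - \<epsilon>) *\<^sub>R u j)" for i
    using zero by (simp add: mix_def scaleR_left_diff_distrib sum_subtractf
        flip: scaleR_sum_right)
  then have "norm (mix w u i) \<le> (\<Sum>j\<in>UNIV. (w i j - \<epsilon>) * norm (u j))" for i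
    using lower by (auto intro!: sum_norm_le)
  then have "(\<Sum>i\<in>UNIV. norm (mix w u i)) \<le> (\<Sum>i\<in>UNIV. \<Sum>j\<in>UNIV. (w i j - \<epsilon>) * norm (u j))"
    by (intro sum_mono)
  also have "\<dots> = (\<Sum>j\<in>UNIV. (1 - real CARD('n) * \<epsilon>) * norm (u j))"
    by (subst sum.swap)
      (use w in \<open>simp add: column_stochastic_def sum_subtractf flip: sum_distrib_right\<close>)
  also have "\<dots> \<le> (\<Sum>j\<in>UNIV. (1 - \<epsilon>) * norm (u j))"
  proof -
    have "1 * \<epsilon> \<le> real CARD('n) * \<epsilon>"
      using \<open>0 \<le> \<epsilon>\<close> by (intro mult_right_mono) (auto simp: Suc_le_eq)
    then show ?thesis by (intro sum_mono mult_right_mono) auto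
  qed
  finally show ?thesis by (simp add: sum_distrib_left)
qed

text \<open>
  The deviation \<open>r\<close> from the unperturbed evolution obeys the same recursion from initial value zero.
  A single averaging step does not increase its spread, so it gains at most \<open>\<kappa>\<close> per step;
  the contraction is only needed for the unperturbed evolution.
\<close>

lemma perturbed_row_mix_spread_le:
  fixes u :: "nat \<Rightarrow> 'n::finite \<Rightarrow> 'a::real_normed_vector"
  assumes W: "\<And>t. row_stochastic (W t)"
    and lower: "\<And>i j. \<epsilon> \<le> weight_product W T i j"
    and step: "\<And>t i. u (Suc t) i = mix (W t) (u t) i + e t i"
    and err: "\<And>t i j. t < T \<Longrightarrow> norm (e t i - e t j) \<le> \<kappa>"
    and spread: "\<And>i j. norm (u 0 i - u 0 j) \<le> d"
  shows "norm (u T i - u T j) \<le> (1 - \<epsilon>) * d + real T * \<kappa>"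
proof -
  define r where "r t i = u t i - mix (weight_product W t) (u 0) i" for t i
  have r_Suc: "r (Suc t) i = mix (W t) (r t) i + e t i" for t i
    unfolding r_def mix_diff step mix_weight_product_Suc by simp
  have "norm (r t i - r t j) \<le> real t * \<kappa>" if "t \<le> T" for t i j
    using that
  proof (induction t arbitrary: i j)
    case 0
    then show ?case by (simp add: r_def mix_weight_product_0 del: weight_product.simps)
  next
    case (Suc t)
    have "norm (mix (W t) (r t) i - mix (W t) (r t) j) \<le> (1 - 0) * (real t * \<kappa>)"
      using W[of t] Suc by (intro row_mix_spread_le) (auto simp: row_stochastic_def)
    moreover have "norm (e t i - e t j) \<le> \<kappa>" using Suc.prems by (intro err) simp
    moreover have "r (Suc t) i - r (Suc t) j
        = (mix (W t) (r t) i - mix (W t) (r t) j) + (e t i - e t j)"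
      by (simp add: r_Suc)
    ultimately have "norm (r (Suc t) i - r (Suc t) j) \<le> (1 - 0) * (real t * \<kappa>) + \<kappa>"
      by (metis add_mono norm_triangle_le)
    then show ?case by (simp add: algebra_simps)
  qed
  from this[of T i j] have "norm (r T i - r T j) \<le> real T * \<kappa>" by simp
  moreover have "norm (mix (weight_product W T) (u 0) i - mix (weight_product W T) (u 0) j)
      \<le> (1 - \<epsilon>) * d"
    by (intro row_mix_spread_le row_stochastic_weight_product W lower spread)
  moreover have "u T i - u T j = (r T i - r T j)
      + (mix (weight_product W T) (u 0) i - mix (weight_product W T) (u 0) j)"
    by (simp add: r_def)
  ultimately show ?thesis by (metis add.commute add_mono norm_triangle_le)
qed

text \<open>
  The column stochastic counterpart, with the same decomposition: perturbations enter through the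
  nonexpansiveness of single steps, the initial vector through the contraction of zero sums.
\<close>

lemma perturbed_column_mix_sum_norm_le:
  fixes u :: "nat \<Rightarrow> 'n::finite \<Rightarrow> 'a::real_normed_vector"
  assumes W: "\<And>t. column_stochastic (W t)"
    and lower: "\<And>i j. \<epsilon> \<le> weight_product W T i j" and "0 \<le> \<epsilon>"
    and step: "\<And>t i. u (Suc t) i = mix (W t) (u t) i + e t i"
    and err: "\<And>t. t < T \<Longrightarrow> (\<Sum>i\<in>UNIV. norm (e t i)) \<le> \<kappa>"
    and zero: "(\<Sum>i\<in>UNIV. u 0 i) = 0"
    and size: "(\<Sum>i\<in>UNIV. norm (u 0 i)) \<le> d" and "\<epsilon> \<le> 1"
  shows "(\<Sum>i\<in>UNIV. norm (u T i)) \<le> (1 - \<epsilon>) * d + real T * \<kappa>"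
proof -
  have triangle: "(\<Sum>i\<in>UNIV. norm (p i + q i)) \<le> (\<Sum>i\<in>UNIV. norm (p i)) + (\<Sum>i\<in>UNIV. norm (q i))"
    for p q :: "'n \<Rightarrow> 'a"
    by (simp add: sum_mono norm_triangle_ineq flip: sum.distrib)
  define r where "r t i = u t i - mix (weight_product W t) (u 0) i" for t i
  have r_Suc: "r (Suc t) i = mix (W t) (r t) i + e t i" for t i
    unfolding r_def mix_diff step mix_weight_product_Suc by simp
  have "(\<Sum>i\<in>UNIV. norm (r t i)) \<le> real t * \<kappa>" if "t \<le> T" for t
    using that
  proof (induction t)
    case 0
    then show ?case by (simp add: r_def mix_weight_product_0 del: weight_product.simps)
  next
    case (Suc t)
    have "(\<Sum>i\<in>UNIV. norm (r (Suc t) i))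
        \<le> (\<Sum>i\<in>UNIV. norm (r t i)) + (\<Sum>i\<in>UNIV. norm (e t i))"
      unfolding r_Suc using triangle column_mix_sum_norm_le[OF W] add_right_mono order_trans
      by blast
    with Suc err[of t] show ?case by (simp add: algebra_simps)
  qed
  from this[of T] have "(\<Sum>i\<in>UNIV. norm (r T i)) \<le> real T * \<kappa>" by simp
  moreover have "(\<Sum>i\<in>UNIV. norm (mix (weight_product W T) (u 0) i)) \<le> (1 - \<epsilon>) * d"
    using column_mix_sum_norm_contraction[OF column_stochastic_weight_product[of W T] lower
        \<open>0 \<le> \<epsilon>\<close> zero] W mult_left_mono[OF size, of "1 - \<epsilon>"] \<open>\<epsilon> \<le> 1\<close> by fastforce
  moreover have "u T = (\<lambda>i. mix (weight_product W T) (u 0) i + r T i)"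
    by (simp add: r_def)
  ultimately show ?thesis using triangle[of "mix (weight_product W T) (u 0)" "r T"]
    by simp
qed

section \<open>Gradients and the gradient step\<close>

text \<open>
  Expanding the square gives the factor \<open>1 - 2 t \<alpha> + t\<^sup>2 L\<^sup>2 \<le> 1 - t \<alpha> \<le> (1 - t \<alpha> / 2)\<^sup>2\<close>; the first
  inequality is the stepsize condition \<open>t * L\<^sup>2 \<le> \<alpha>\<close>.
\<close>

lemma gradient_step_contraction:
  fixes G :: "'a::real_inner \<Rightarrow> 'a"
  assumes mono: "\<alpha> * (norm (z - p))\<^sup>2 \<le> (G z - G p) \<bullet> (z - p)"
    and lips: "norm (G z - G p) \<le> L * norm (z - p)" and zero: "G p = 0"
    and t: "0 \<le> t" "t * L\<^sup>2 \<le> \<alpha>" "t * \<alpha> \<le> 2"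
  shows "norm (z - t *\<^sub>R G z - p) \<le> (1 - t * \<alpha> / 2) * norm (z - p)"
proof (rule power2_le_imp_le)
  have "(norm (G z))\<^sup>2 \<le> L\<^sup>2 * (norm (z - p))\<^sup>2"
    using power_mono[OF lips, of 2] zero by (simp add: power_mult_distrib)
  then have "t * (t * (norm (G z))\<^sup>2) \<le> t * (t * (L\<^sup>2 * (norm (z - p))\<^sup>2))"
    using t by (intro mult_left_mono)
  also have "\<dots> = t * ((t * L\<^sup>2) * (norm (z - p))\<^sup>2)" by simp
  also have "\<dots> \<le> t * (\<alpha> * (norm (z - p))\<^sup>2)"
    using t by (intro mult_left_mono mult_right_mono) auto
  finally have grad: "t * (t * (norm (G z))\<^sup>2) \<le> t * (\<alpha> * (norm (z - p))\<^sup>2)" .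
  have mono': "t * (\<alpha> * (norm (z - p))\<^sup>2) \<le> t * (G z \<bullet> (z - p))"
    using mono zero t by (intro mult_left_mono) auto
  have "(norm (z - t *\<^sub>R G z - p))\<^sup>2
      = (norm (z - p))\<^sup>2 - 2 * (t * (G z \<bullet> (z - p))) + t * (t * (norm (G z))\<^sup>2)"
    by (simp add: power2_norm_eq_inner inner_diff_left inner_diff_right inner_commute algebra_simps)
  also have "\<dots> \<le> (1 - t * \<alpha>) * (norm (z - p))\<^sup>2"
    using grad mono' by (simp add: algebra_simps)
  also have "\<dots> \<le> ((1 - t * \<alpha> / 2) * norm (z - p))\<^sup>2"
  proof -
    have "1 - t * \<alpha> \<le> (1 - t * \<alpha> / 2)\<^sup>2"
      using zero_le_power2[of "t * \<alpha>"] by (simp add: power2_eq_square algebra_simps)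
    then show ?thesis unfolding power_mult_distrib by (intro mult_right_mono) auto
  qed
  finally show "(norm (z - t *\<^sub>R G z - p))\<^sup>2 \<le> ((1 - t * \<alpha> / 2) * norm (z - p))\<^sup>2" .
  show "0 \<le> (1 - t * \<alpha> / 2) * norm (z - p)" using t by (intro mult_nonneg_nonneg) auto
qed

lemma gradient_eqI:
  fixes f :: "'a::euclidean_space \<Rightarrow> real"
  assumes "GDERIV f x :> D"
  shows "gradient f x = D"
proof -
  have "f differentiable (at x)"
    using assms unfolding gderiv_def differentiable_def by blast
  then have "(\<lambda>h. h \<bullet> gradient f x) = (\<lambda>h. h \<bullet> D)"
    using GDERIV_gradient assms unfolding gderiv_def by (blast intro: has_derivative_unique)
  then show ?thesis by (metis vector_eq_ldot)
qed

text \<open>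
  Strong convexity is assumed of the sum, smoothness of the summands, and the algorithm evaluates
  the gradients of the summands; this identity connects them.
\<close>

lemma gradient_sum:
  fixes f :: "'n \<Rightarrow> 'a::euclidean_space \<Rightarrow> real"
  assumes "\<And>i. i \<in> I \<Longrightarrow> f i differentiable (at x)"
  shows "gradient (\<lambda>x. \<Sum>i\<in>I. f i x) x = (\<Sum>i\<in>I. gradient (f i) x)"
proof (rule gradient_eqI)
  have "((\<lambda>x. \<Sum>i\<in>I. f i x) has_derivative (\<lambda>h. \<Sum>i\<in>I. h \<bullet> gradient (f i) x)) (at x)"
    using GDERIV_gradient[OF assms] by (intro has_derivative_sum) (simp add: gderiv_def)
  then show "GDERIV (\<lambda>x. \<Sum>i\<in>I. f i x) x :> (\<Sum>i\<in>I. gradient (f i) x)"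
    by (simp add: gderiv_def inner_sum_right)
qed

lemma gradient_arg_min:
  fixes f :: "'a::euclidean_space \<Rightarrow> real"
  assumes "f differentiable (at x)" "is_arg_min f (\<lambda>x. True) x"
  shows "gradient f x = 0"
proof -
  have "(\<lambda>h. h \<bullet> gradient f x) = (\<lambda>h. 0)"
    by (rule differential_zero_maxmin[of x UNIV f])
      (use assms GDERIV_gradient in \<open>auto simp: gderiv_def is_arg_min_linorder\<close>)
  then show ?thesis by (metis inner_eq_zero_iff)
qed

section \<open>Error recursions of gradient tracking\<close>

text \<open>
  The two gains are the ratios, in units of the stepsize, at which spread and residual settle
  relative to the distance from the minimizer. They are the values for which the perturbation
  accumulated in \<open>T\<close> steps is \<open>\<epsilon> / 2\<close> times the error itself, half of what the contraction removes.
\<close>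

definition spread_gain :: "real \<Rightarrow> real \<Rightarrow> nat \<Rightarrow> real" where
  "spread_gain L \<epsilon> T = 4 * real T * (L + 1) / \<epsilon>"

definition resid_gain :: "real \<Rightarrow> real \<Rightarrow> nat \<Rightarrow> real" where
  "resid_gain L \<epsilon> T = 4 * real T * L * (spread_gain L \<epsilon> T + L + 1) / \<epsilon>"

lemma spread_gain_pos:
  assumes "0 < L" "0 < \<epsilon>" "1 \<le> T"
  shows "0 < spread_gain L \<epsilon> T"
  unfolding spread_gain_def
  by (rule divide_pos_pos[OF mult_pos_pos]) (use assms in simp_all)

lemma resid_gain_pos:
  assumes "0 < L" "0 < \<epsilon>" "1 \<le> T"
  shows "0 < resid_gain L \<epsilon> T"
  unfolding resid_gain_def
  by (rule divide_pos_pos[OF mult_pos_pos[OF mult_pos_pos]])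
    (use assms spread_gain_pos[OF assms] in simp_all)

text \<open>
  The second phase of the algorithm, with time counted from its beginning and with maps \<open>g i\<close>
  that share the relevant properties of the gradients. The graph enters only through the lower
  bound \<open>\<epsilon>\<close> on the products of \<open>T\<close> consecutive weight matrices, and the first phase only through
  the identity \<open>y_0\<close>.
\<close>

locale gradient_tracking =
  fixes r a c b :: "nat \<Rightarrow> 'n::finite \<Rightarrow> 'n \<Rightarrow> real"
    and g :: "'n \<Rightarrow> 'a::real_inner \<Rightarrow> 'a"
    and \<beta> :: "'n \<Rightarrow> real" and \<alpha> L \<epsilon> l :: real and T :: nat and p :: 'a
    and x y :: "nat \<Rightarrow> 'n \<Rightarrow> 'a"
  assumes r: "\<And>k. row_stochastic (r k)" and a: "\<And>k. row_stochastic (a k)"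
    and c: "\<And>k. column_stochastic (c k)" and b: "\<And>k. column_stochastic (b k)"
    and r_mixing: "\<And>k i j. \<epsilon> \<le> weight_product (\<lambda>t. r (k + t)) T i j"
    and c_mixing: "\<And>k i j. \<epsilon> \<le> weight_product (\<lambda>t. c (k + t)) T i j"
    and eps: "0 < \<epsilon>" "\<epsilon> \<le> 1" and T: "1 \<le> T"
    and lipschitz: "\<And>i u v. norm (g i u - g i v) \<le> \<beta> i * norm (u - v)" "\<And>i. 0 < \<beta> i"
    and L: "L = (\<Sum>i\<in>UNIV. \<beta> i)"
    and strong_mono: "\<And>u v. \<alpha> * (norm (u - v))\<^sup>2 \<le>
          ((\<Sum>i\<in>UNIV. g i u) - (\<Sum>i\<in>UNIV. g i v)) \<bullet> (u - v)" "0 < \<alpha>"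
    and stationary: "(\<Sum>i\<in>UNIV. g i p) = 0"
    and l: "0 < l"
    and x_Suc: "\<And>k i. x (Suc k) i = mix (r k) (x k) i - l *\<^sub>R mix (a k) (y k) i"
    and y_Suc: "\<And>k i. y (Suc k) i = mix (c k) (y k) i
          + mix (b k) (\<lambda>j. g j (x (Suc k) j) - g j (x k j)) i"
    and y_0: "(\<Sum>i\<in>UNIV. y 0 i) = (\<Sum>i\<in>UNIV. g i (x 0 i))"
begin

definition total :: "nat \<Rightarrow> 'a" where
  "total k = (\<Sum>i\<in>UNIV. g i (x k i))"

text \<open>
  The shares in which the column stochastic weights distribute the tracked sum among the nodes.
  They start uniform; after \<open>T\<close> steps the initial choice no longer affects their lower bound.
\<close>

definition profile :: "nat \<Rightarrow> 'n \<Rightarrow> real" where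
  "profile k = mix (weight_product c k) (\<lambda>_. 1 / real CARD('n))"

definition resid :: "nat \<Rightarrow> 'n \<Rightarrow> 'a" where
  "resid k i = y k i - profile k i *\<^sub>R total k"

definition diff :: "nat \<Rightarrow> 'n \<Rightarrow> 'a" where
  "diff k j = g j (x (Suc k) j) - g j (x k j)"

definition innovation :: "nat \<Rightarrow> 'n \<Rightarrow> 'a" where
  "innovation k i = mix (b k) (diff k) i - profile (Suc k) i *\<^sub>R (\<Sum>j\<in>UNIV. diff k j)"

lemma L_pos: "0 < L"
  unfolding L using lipschitz(2) by (intro sum_pos) auto

lemma total_Suc: "total (Suc k) = total k + (\<Sum>j\<in>UNIV. diff k j)"
  by (simp add: total_def diff_def sum_subtractf)

lemma sum_y: "(\<Sum>i\<in>UNIV. y k i) = total k"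
proof (induction k)
  case (Suc k)
  then show ?case
    unfolding total_Suc y_Suc diff_def[symmetric] sum.distrib sum_column_mix[OF c]
      sum_column_mix[OF b] by simp
qed (simp add: y_0 total_def)

lemma profile_Suc: "profile (Suc k) i = mix (c k) (profile k) i"
  unfolding profile_def mix_weight_product_Suc ..

lemma sum_profile: "(\<Sum>i\<in>UNIV. profile k i) = 1"
  unfolding profile_def
  by (subst sum_column_mix) (auto intro: column_stochastic_weight_product c)

lemma profile_nonneg: "0 \<le> profile k i"
  using column_stochastic_weight_product[of c k, OF c]
  by (auto simp: profile_def mix_def column_stochastic_def intro!: sum_nonneg)

lemma profile_le_1: "profile k i \<le> 1"
  using member_le_sum[of i UNIV "profile k"] profile_nonneg sum_profile[of k] by auto

lemma profile_ge:
  assumes "T \<le> k"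
  shows "\<epsilon> \<le> profile k i"
proof -
  define h where "h = k - T"
  have "profile (h + t) i = mix (weight_product (\<lambda>t. c (h + t)) t) (profile (h + 0)) i" for t i
    by (rule iterated_mix[of "\<lambda>t. profile (h + t)"]) (simp add: profile_Suc)
  from this[of T i] have "profile k i = mix (weight_product (\<lambda>t. c (h + t)) T) (profile h) i"
    using assms by (simp add: h_def)
  also have "\<dots> \<ge> (\<Sum>j\<in>UNIV. \<epsilon> * profile h j)"
    unfolding mix_def real_scaleR_def
    by (intro sum_mono mult_right_mono c_mixing profile_nonneg)
  finally show ?thesis by (simp add: sum_profile flip: sum_distrib_left)
qed

lemma sum_resid: "(\<Sum>i\<in>UNIV. resid k i) = 0"
  by (simp add: resid_def sum_subtractf sum_y sum_profile flip: scaleR_sum_left)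

text \<open>
  Both \<open>y\<close> and its ideal value evolve by the same weights \<open>c\<close>, so the only perturbation is the
  difference between the distribution of the new gradient increments by \<open>b\<close> and their ideal
  distribution by \<open>profile\<close>.
\<close>

lemma resid_Suc: "resid (Suc k) i = mix (c k) (resid k) i + innovation k i"
proof -
  have "mix (c k) (\<lambda>j. profile k j *\<^sub>R total k) i = profile (Suc k) i *\<^sub>R total k"
    unfolding profile_Suc by (simp add: mix_def scaleR_sum_left)
  then show ?thesis
    unfolding resid_def[abs_def] mix_diff innovation_def total_Suc y_Suc diff_def[symmetric]
    by (simp add: scaleR_right_distrib)
qed

lemma weighted_lipschitz:
  assumes "\<And>i. norm (u i - v i) \<le> d"
  shows "(\<Sum>i\<in>UNIV. norm (g i (u i) - g i (v i))) \<le> L * d"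
proof -
  have "(\<Sum>i\<in>UNIV. norm (g i (u i) - g i (v i))) \<le> (\<Sum>i\<in>UNIV. \<beta> i * d)"
    using assms lipschitz(2)
    by (intro sum_mono order_trans[OF lipschitz(1)] mult_left_mono) (auto intro: less_imp_le)
  then show ?thesis by (simp add: L sum_distrib_right)
qed

lemma norm_sum_gradient_diff_le:
  assumes "\<And>i. norm (u i - v i) \<le> d"
  shows "norm ((\<Sum>i\<in>UNIV. g i (u i)) - (\<Sum>i\<in>UNIV. g i (v i))) \<le> L * d"
  unfolding sum_subtractf[symmetric]
  using norm_sum weighted_lipschitz[OF assms] by (rule order_trans)

lemma norm_total_le:
  assumes "\<And>i. norm (x k i - p) \<le> m"
  shows "norm (total k) \<le> L * m"
  using norm_sum_gradient_diff_le[of "x k" "\<lambda>_. p", OF assms] stationary by (simp add: total_def)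

lemma norm_y_le:
  assumes "\<And>i. norm (x k i - p) \<le> m" "(\<Sum>i\<in>UNIV. norm (resid k i)) \<le> v"
  shows "norm (y k i) \<le> L * m + v"
proof -
  have "norm (profile k i *\<^sub>R total k) \<le> 1 * (L * m)"
    unfolding norm_scaleR using norm_total_le[OF assms(1)] profile_le_1 profile_nonneg
    by (intro mult_mono) auto
  moreover have "norm (resid k i) \<le> v"
    using assms(2) member_le_sum[of i UNIV "\<lambda>i. norm (resid k i)"] by auto
  moreover have "y k i = profile k i *\<^sub>R total k + resid k i" by (simp add: resid_def)
  ultimately show ?thesis by (metis add_mono mult_1 norm_triangle_le)
qed

lemma norm_descent_le:
  assumes "\<And>i. norm (x k i - p) \<le> m" "(\<Sum>i\<in>UNIV. norm (resid k i)) \<le> v"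
  shows "norm (l *\<^sub>R mix (a k) (y k) i) \<le> l * (L * m + v)"
  using norm_row_mix_diff_le[OF a, of "y k" 0 "L * m + v"] norm_y_le[OF assms] l
  by (simp add: mult_left_mono)

lemma norm_x_Suc_diff_le:
  assumes "\<And>i. norm (x k i - p) \<le> m" "\<And>i j. norm (x k i - x k j) \<le> d"
    and "(\<Sum>i\<in>UNIV. norm (resid k i)) \<le> v"
  shows "norm (x (Suc k) i - x k i) \<le> d + l * (L * m + v)"
proof -
  have "norm (mix (r k) (x k) i - x k i) \<le> d"
    using assms(2) by (intro norm_row_mix_diff_le r)
  moreover have "x (Suc k) i - x k i
      = (mix (r k) (x k) i - x k i) - l *\<^sub>R mix (a k) (y k) i" by (simp add: x_Suc)
  ultimately show ?thesis
    using norm_descent_le[OF assms(1,3), of i] by (simp only: norm_triangle_le_diff add_mono)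
qed

lemma sum_norm_innovation_le:
  assumes "\<And>i. norm (x k i - p) \<le> m" "\<And>i j. norm (x k i - x k j) \<le> d"
    and "(\<Sum>i\<in>UNIV. norm (resid k i)) \<le> v"
  shows "(\<Sum>i\<in>UNIV. norm (innovation k i)) \<le> 2 * (L * (d + l * (L * m + v)))"
proof -
  let ?D = "\<Sum>j\<in>UNIV. norm (diff k j)"
  have D: "?D \<le> L * (d + l * (L * m + v))"
    unfolding diff_def by (intro weighted_lipschitz norm_x_Suc_diff_le assms)
  have "norm (innovation k i) \<le> norm (mix (b k) (diff k) i) + profile (Suc k) i * ?D" for i
  proof -
    have "norm (profile (Suc k) i *\<^sub>R (\<Sum>j\<in>UNIV. diff k j)) \<le> profile (Suc k) i * ?D"
      using profile_nonneg by (simp add: mult_left_mono norm_sum)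
    then show ?thesis
      unfolding innovation_def by (intro norm_triangle_le_diff add_mono order_refl)
  qed
  then have "(\<Sum>i\<in>UNIV. norm (innovation k i))
      \<le> (\<Sum>i\<in>UNIV. norm (mix (b k) (diff k) i) + profile (Suc k) i * ?D)"
    by (intro sum_mono)
  also have "\<dots> \<le> ?D + ?D"
    using column_mix_sum_norm_le[OF b]
    by (simp add: sum.distrib sum_profile flip: sum_distrib_right)
  finally show ?thesis using D by simp
qed

lemma spread_after_T:
  assumes "\<And>i j. norm (x k i - x k j) \<le> d"
    and "\<And>t i. t < T \<Longrightarrow> norm (x (k + t) i - p) \<le> m"
    and "\<And>t. t < T \<Longrightarrow> (\<Sum>i\<in>UNIV. norm (resid (k + t) i)) \<le> v"
  shows "norm (x (k + T) i - x (k + T) j) \<le> (1 - \<epsilon>) * d + real T * (2 * (l * (L * m + v)))"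
proof (rule perturbed_row_mix_spread_le[where W = "\<lambda>t. r (k + t)" and u = "\<lambda>t. x (k + t)"
      and e = "\<lambda>t i. - (l *\<^sub>R mix (a (k + t)) (y (k + t)) i)"])
  fix t i j assume t: "t < T"
  have *: "norm (l *\<^sub>R mix (a (k + t)) (y (k + t)) i) \<le> l * (L * m + v)" for i
    using assms(2,3) t by (intro norm_descent_le) auto
  show "norm (- (l *\<^sub>R mix (a (k + t)) (y (k + t)) i) - - (l *\<^sub>R mix (a (k + t)) (y (k + t)) j))
      \<le> 2 * (l * (L * m + v))"
    using *[of i] *[of j]
      norm_triangle_ineq4[of "- (l *\<^sub>R mix (a (k + t)) (y (k + t)) i)"
        "- (l *\<^sub>R mix (a (k + t)) (y (k + t)) j)"]
    unfolding norm_minus_cancel by linarith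
qed (use assms in \<open>auto simp: r r_mixing x_Suc\<close>)

lemma resid_after_T:
  assumes "(\<Sum>i\<in>UNIV. norm (resid k i)) \<le> v'"
    and "\<And>t i. t < T \<Longrightarrow> norm (x (k + t) i - p) \<le> m"
    and "\<And>t i j. t < T \<Longrightarrow> norm (x (k + t) i - x (k + t) j) \<le> d"
    and "\<And>t. t < T \<Longrightarrow> (\<Sum>i\<in>UNIV. norm (resid (k + t) i)) \<le> v"
  shows "(\<Sum>i\<in>UNIV. norm (resid (k + T) i))
      \<le> (1 - \<epsilon>) * v' + real T * (2 * (L * (d + l * (L * m + v))))"
proof (rule perturbed_column_mix_sum_norm_le[where W = "\<lambda>t. c (k + t)" and u = "\<lambda>t. resid (k + t)"
      and e = "\<lambda>t. innovation (k + t)"])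
  show "(\<Sum>i\<in>UNIV. norm (innovation (k + t) i)) \<le> 2 * (L * (d + l * (L * m + v)))"
    if "t < T" for t
    using assms(2,3,4) that by (intro sum_norm_innovation_le) auto
qed (use assms eps in \<open>auto simp: c c_mixing resid_Suc sum_resid\<close>)

text \<open>
  With \<open>y = profile *\<^sub>R total + resid\<close>, the descent direction of node \<open>i\<close> is \<open>s *\<^sub>R total\<close> plus an
  average of residuals, where \<open>s\<close> is a share between \<open>\<epsilon>\<close> and \<open>1\<close>. Up to an error \<open>L d\<close>, the vector
  \<open>total\<close> is the gradient \<open>G z\<close> of the global objective at the average \<open>z\<close> to which the node moves,
  hence the node performs a perturbed gradient step at \<open>z\<close>.
\<close>

lemma dist_Suc_le:
  assumes "T \<le> k" and l_small: "l * L\<^sup>2 \<le> \<alpha>" "l * \<alpha> \<le> 2"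
    and m: "\<And>i. norm (x k i - p) \<le> m" and d: "\<And>i j. norm (x k i - x k j) \<le> d"
    and v: "(\<Sum>i\<in>UNIV. norm (resid k i)) \<le> v"
  shows "norm (x (Suc k) i - p) \<le> (1 - l * \<epsilon> * \<alpha> / 2) * m + l * (L * d + v)"
proof -
  define s where "s = mix (a k) (profile k) i"
  define z where "z = mix (r k) (x k) i"
  define G where "G u = (\<Sum>i\<in>UNIV. g i u)" for u
  \<comment> \<open>a row stochastic average of shares, each at least \<open>\<epsilon>\<close> from time \<open>T\<close> on\<close>
  have "\<epsilon> \<le> s"
  proof -
    have "\<epsilon> = (\<Sum>j\<in>UNIV. a k i j * \<epsilon>)"
      using a[of k] by (simp add: row_stochastic_def flip: sum_distrib_right)
    also have "\<dots> \<le> s" unfolding s_def mix_def real_scaleR_def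
      using a[of k] by (intro sum_mono mult_left_mono profile_ge assms) (auto simp: row_stochastic_def)
    finally show ?thesis .
  qed
  have "s \<le> 1"
    using norm_row_mix_diff_le[OF a, of "profile k" 0 1] profile_nonneg profile_le_1
    by (force simp: s_def abs_le_iff)
  have s: "0 \<le> l * s" "l * \<epsilon> \<le> l * s" "l * s \<le> l"
    using \<open>\<epsilon> \<le> s\<close> \<open>s \<le> 1\<close> l eps by (auto simp: mult_le_cancel_left1)
  have y: "y k = (\<lambda>j. profile k j *\<^sub>R total k + resid k j)"
    by (auto simp: resid_def)
  have "mix (a k) (y k) i = s *\<^sub>R total k + mix (a k) (resid k) i"
    unfolding y mix_add by (simp add: s_def mix_def scaleR_sum_left)
  then have split: "x (Suc k) i - p = (z - (l * s) *\<^sub>R G z - p)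
      + ((l * s) *\<^sub>R (G z - total k) + - (l *\<^sub>R mix (a k) (resid k) i))"
    unfolding x_Suc z_def[symmetric] by (simp add: algebra_simps)
  have "norm (z - p) \<le> m"
    unfolding z_def by (intro norm_row_mix_diff_le r m)
  have descent: "norm (z - (l * s) *\<^sub>R G z - p) \<le> (1 - l * \<epsilon> * \<alpha> / 2) * m"
  proof -
    have "norm (z - (l * s) *\<^sub>R G z - p) \<le> (1 - (l * s) * \<alpha> / 2) * norm (z - p)"
    proof (rule gradient_step_contraction)
      show "norm (G z - G p) \<le> L * norm (z - p)"
        unfolding G_def by (rule norm_sum_gradient_diff_le) simp
      show "(l * s) * L\<^sup>2 \<le> \<alpha>"
        using mult_right_mono[OF s(3), of "L\<^sup>2"] l_small by simp
      show "(l * s) * \<alpha> \<le> 2"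
        using mult_right_mono[OF s(3), of \<alpha>] l_small strong_mono(2) by simp
      show "\<alpha> * (norm (z - p))\<^sup>2 \<le> (G z - G p) \<bullet> (z - p)"
        unfolding G_def by (rule strong_mono)
    qed (use stationary s in \<open>auto simp: G_def\<close>)
    also have "\<dots> \<le> (1 - l * \<epsilon> * \<alpha> / 2) * m"
      using mult_right_mono[OF s(2), of \<alpha>] mult_right_mono[OF s(3), of \<alpha>] l_small(2) strong_mono(2)
        \<open>norm (z - p) \<le> m\<close>
      by (intro mult_mono) auto
    finally show ?thesis .
  qed
  have "norm (G z - total k) \<le> L * d"
    unfolding G_def total_def
  proof (rule norm_sum_gradient_diff_le)
    show "norm (z - x k i) \<le> d" for i
      unfolding z_def by (intro norm_row_mix_diff_le r d)
  qed
  then have "norm ((l * s) *\<^sub>R (G z - total k)) \<le> l * (L * d)"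
    using s l unfolding norm_scaleR by (intro mult_mono) auto
  moreover have "norm (- (l *\<^sub>R mix (a k) (resid k) i)) \<le> l * v"
  proof -
    have "norm (mix (a k) (resid k) i - 0) \<le> v"
      using v member_le_sum[of _ UNIV "\<lambda>i. norm (resid k i)"]
      by (intro norm_row_mix_diff_le a) (auto intro: order_trans)
    then show ?thesis using l by simp
  qed
  ultimately have "norm ((l * s) *\<^sub>R (G z - total k) + - (l *\<^sub>R mix (a k) (resid k) i))
      \<le> l * (L * d) + l * v"
    by (metis add_mono norm_triangle_le)
  with descent show ?thesis
    unfolding split by (metis add_mono distrib_left norm_triangle_le)
qed

definition rate :: real where
  "rate = 1 - l * \<epsilon> * \<alpha> / 4"

abbreviation (input) "\<sigma> \<equiv> spread_gain L \<epsilon> T"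

abbreviation (input) "\<tau> \<equiv> resid_gain L \<epsilon> T"

lemmas gains_pos = spread_gain_pos[OF L_pos eps(1) T] resid_gain_pos[OF L_pos eps(1) T]

text \<open>
  The shape of the induction hypothesis: one number \<open>m\<close> bounds all three errors, spread and residual
  being smaller by a factor proportional to the stepsize.
\<close>

definition errors_below :: "nat \<Rightarrow> real \<Rightarrow> bool" where
  "errors_below k m \<longleftrightarrow> (\<forall>i. norm (x k i - p) \<le> m)
     \<and> (\<forall>i j. norm (x k i - x k j) \<le> \<sigma> * l * m)
     \<and> (\<Sum>i\<in>UNIV. norm (resid k i)) \<le> \<tau> * l * m"

lemma errors_below_mono:
  assumes "errors_below k m" "m \<le> m'"
  shows "errors_below k m'"
proof -
  have "\<sigma> * l * m \<le> \<sigma> * l * m'" "\<tau> * l * m \<le> \<tau> * l * m'"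
    using assms(2) gains_pos l by (auto intro!: mult_left_mono)
  with assms show ?thesis unfolding errors_below_def by (meson order_trans)
qed

text \<open>
  Since \<open>m\<close> may be as large as the state requires, the hypothesis holds at any single time. This
  provides the base of the induction, and is the point at which the constant depends on the run.
\<close>

lemma errors_below_exists:
  obtains m where "0 \<le> m" "errors_below k m"
proof -
  define X where "X = (\<Sum>i\<in>UNIV. norm (x k i - p))"
  define S where "S = (\<Sum>i\<in>UNIV. \<Sum>j\<in>UNIV. norm (x k i - x k j))"
  define V where "V = (\<Sum>i\<in>UNIV. norm (resid k i))"
  define m where "m = X + S / (\<sigma> * l) + V / (\<tau> * l)"
  have pos: "0 < \<sigma> * l" "0 < \<tau> * l" using gains_pos l by auto
  have nn: "0 \<le> X" "0 \<le> S / (\<sigma> * l)" "0 \<le> V / (\<tau> * l)"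
    unfolding X_def S_def V_def
    using pos by (auto intro!: sum_nonneg divide_nonneg_nonneg simp: less_imp_le)
  then have "S / (\<sigma> * l) \<le> m" "V / (\<tau> * l) \<le> m" and Xm: "X \<le> m"
    by (auto simp: m_def)
  then have Sm: "S \<le> \<sigma> * l * m" and Vm: "V \<le> \<tau> * l * m"
    using pos by (auto simp: pos_divide_le_eq mult.commute)
  have X: "norm (x k i - p) \<le> X" for i
    unfolding X_def by (rule member_le_sum) auto
  have S: "norm (x k i - x k j) \<le> S" for i j
  proof -
    have "norm (x k i - x k j) \<le> (\<Sum>j\<in>UNIV. norm (x k i - x k j))"
      by (rule member_le_sum) auto
    also have "\<dots> \<le> S"
      unfolding S_def by (rule member_le_sum[of _ _ "\<lambda>i. \<Sum>j\<in>UNIV. norm (x k i - x k j)"])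
        (auto intro: sum_nonneg)
    finally show ?thesis .
  qed
  show thesis
  proof (rule that[of m])
    show "0 \<le> m" using nn by (simp add: m_def)
    show "errors_below k m"
      unfolding errors_below_def V_def[symmetric] using X S Xm Sm Vm order_trans by blast
  qed
qed

text \<open>
  The four smallness conditions on the stepsize: the gradient step contracts; the rate is slow enough
  to lose no more than \<open>\<epsilon> / 2\<close> over \<open>T\<close> steps; the residual stays below the distance bound; and the
  feedback of spread and residual uses up at most half of the contraction of the gradient step.
\<close>

context
  assumes l_L: "l * L\<^sup>2 \<le> \<alpha>" and l_T: "real T * (l * \<alpha>) \<le> 2" and l_resid: "\<tau> * l \<le> 1"
    and l_loop: "l * (L * \<sigma> + \<tau>) \<le> \<epsilon> * \<alpha> / 4"
begin

lemma l_alpha: "l * \<alpha> \<le> 2"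
proof -
  have "1 * (l * \<alpha>) \<le> real T * (l * \<alpha>)"
    using T l strong_mono(2) by (intro mult_right_mono) auto
  with l_T show ?thesis by simp
qed

text \<open>
  The contraction by \<open>1 - \<epsilon>\<close>, weakened by perturbations worth \<open>\<epsilon> / 2\<close>, leaves the factor
  \<open>1 - \<epsilon> / 2\<close> over \<open>T\<close> steps; Bernoulli's inequality keeps \<open>rate ^ T\<close> above it.
\<close>

lemma rate: "0 < rate" "rate < 1" "1 - \<epsilon> / 2 \<le> rate ^ T"
proof -
  have pos: "0 < l * \<epsilon> * \<alpha>" using l eps strong_mono(2) by simp
  have "\<epsilon> * (l * \<alpha>) \<le> 1 * 2"
    using eps l_alpha l strong_mono(2) by (intro mult_mono) auto
  then have le2: "l * \<epsilon> * \<alpha> \<le> 2" by (simp add: mult_ac)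
  show "0 < rate" "rate < 1" using pos le2 by (auto simp: rate_def)
  have "\<epsilon> * (real T * (l * \<alpha>)) \<le> \<epsilon> * 2"
    using l_T eps by (intro mult_left_mono) auto
  then have "1 - \<epsilon> / 2 \<le> 1 + real T * (- (l * \<epsilon> * \<alpha> / 4))" by (simp add: mult_ac)
  also have "\<dots> \<le> (1 + (- (l * \<epsilon> * \<alpha> / 4))) ^ T"
    by (rule Bernoulli_inequality) (use le2 in simp)
  finally show "1 - \<epsilon> / 2 \<le> rate ^ T" by (simp add: rate_def)
qed

lemma dist_rate:
  assumes "T \<le> k" "errors_below k m" "0 \<le> m"
  shows "norm (x (Suc k) i - p) \<le> m * rate"
proof -
  have "norm (x (Suc k) i - p)
      \<le> (1 - l * \<epsilon> * \<alpha> / 2) * m + l * (L * (\<sigma> * l * m) + \<tau> * l * m)"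
    using assms(2) by (intro dist_Suc_le assms(1) l_L l_alpha) (auto simp: errors_below_def)
  also have "\<dots> = (1 - l * \<epsilon> * \<alpha> / 2) * m + (l * (L * \<sigma> + \<tau>)) * (l * m)"
    by (simp add: algebra_simps)
  also have "\<dots> \<le> (1 - l * \<epsilon> * \<alpha> / 2) * m + \<epsilon> * \<alpha> / 4 * (l * m)"
    using l_loop l assms(3) by (intro add_left_mono mult_right_mono) auto
  also have "\<dots> = m * rate" by (simp add: rate_def algebra_simps)
  finally show ?thesis .
qed

lemma coupling_le:
  assumes "0 \<le> m"
  shows "l * (L * m + \<tau> * l * m) \<le> l * m * (L + 1)"
proof -
  have "\<tau> * l * m \<le> 1 * m" using l_resid assms by (intro mult_right_mono)
  then have "l * (L * m + \<tau> * l * m) \<le> l * (L * m + m)"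
    using l by (intro mult_left_mono) auto
  then show ?thesis by (simp add: algebra_simps)
qed

lemma spread_rate:
  assumes "\<And>t. t < T \<Longrightarrow> errors_below (k + t) m" "0 \<le> m"
  shows "norm (x (k + T) i - x (k + T) j) \<le> \<sigma> * l * (m * rate ^ T)"
proof -
  have "norm (x (k + T) i - x (k + T) j)
      \<le> (1 - \<epsilon>) * (\<sigma> * l * m) + real T * (2 * (l * (L * m + \<tau> * l * m)))"
    using assms(1) assms(1)[of 0] T
    by (intro spread_after_T) (auto simp: errors_below_def)
  also have "\<dots> \<le> (1 - \<epsilon>) * (\<sigma> * l * m) + real T * (2 * (l * m * (L + 1)))"
    using coupling_le[OF assms(2)] by (intro add_left_mono mult_left_mono) auto
  also have "real T * (2 * (l * m * (L + 1))) = \<epsilon> / 2 * (\<sigma> * l * m)"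
    using eps by (simp add: spread_gain_def)
  also have "(1 - \<epsilon>) * (\<sigma> * l * m) + \<epsilon> / 2 * (\<sigma> * l * m) = \<sigma> * l * (m * (1 - \<epsilon> / 2))"
    by (simp add: algebra_simps)
  also have "\<dots> \<le> \<sigma> * l * (m * rate ^ T)"
    using rate(3) gains_pos l assms(2) by (intro mult_left_mono) auto
  finally show ?thesis .
qed

lemma resid_rate:
  assumes "\<And>t. t < T \<Longrightarrow> errors_below (k + t) m" "0 \<le> m"
  shows "(\<Sum>i\<in>UNIV. norm (resid (k + T) i)) \<le> \<tau> * l * (m * rate ^ T)"
proof -
  have "(\<Sum>i\<in>UNIV. norm (resid (k + T) i)) \<le> (1 - \<epsilon>) * (\<tau> * l * m)
      + real T * (2 * (L * (\<sigma> * l * m + l * (L * m + \<tau> * l * m))))"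
    using assms(1) assms(1)[of 0] T
    by (intro resid_after_T) (auto simp: errors_below_def)
  also have "\<dots> \<le> (1 - \<epsilon>) * (\<tau> * l * m)
      + real T * (2 * (L * (\<sigma> * l * m + l * m * (L + 1))))"
    using coupling_le[OF assms(2)] L_pos by (intro add_left_mono mult_left_mono) auto
  also have "real T * (2 * (L * (\<sigma> * l * m + l * m * (L + 1))))
      = \<epsilon> / 2 * (\<tau> * l * m)"
    using eps by (simp add: resid_gain_def field_simps)
  also have "(1 - \<epsilon>) * (\<tau> * l * m) + \<epsilon> / 2 * (\<tau> * l * m) = \<tau> * l * (m * (1 - \<epsilon> / 2))"
    by (simp add: algebra_simps)
  also have "\<dots> \<le> \<tau> * l * (m * rate ^ T)"
    using rate(3) gains_pos l assms(2) by (intro mult_left_mono) auto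
  finally show ?thesis .
qed

text \<open>
  Strong induction with a window of length \<open>T\<close>: the distance is controlled from the previous step,
  spread and residual from the \<open>T\<close> previous steps. The hypothesis is claimed from time \<open>T\<close> on, where
  \<open>profile\<close> is bounded below, so the base consists of the times below \<open>2 * T\<close>.
\<close>

lemma linear_convergence:
  obtains m where "\<And>k i. T \<le> k \<Longrightarrow> norm (x k i - p) \<le> m * rate ^ k"
proof -
  have "\<forall>k. \<exists>m. 0 \<le> m \<and> errors_below k m" using errors_below_exists by blast
  then obtain M where M: "\<And>k. 0 \<le> M k" "\<And>k. errors_below k (M k)" by metis
  \<comment> \<open>large enough to satisfy the hypothesis at the times below \<open>2 * T\<close>\<close>
  define m where "m = (\<Sum>k<2 * T. M k) / rate ^ (2 * T)"
  have m: "0 \<le> m" using M rate by (auto simp: m_def intro!: divide_nonneg_nonneg sum_nonneg)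
  have bound: "errors_below k (m * rate ^ k)" if "T \<le> k" for k
    using that
  proof (induction k rule: less_induct)
    case (less k)
    show ?case
    proof (cases "k < 2 * T")
      case True
      have "M k \<le> (\<Sum>k<2 * T. M k)" using True M by (intro member_le_sum) auto
      also have "\<dots> = m * rate ^ (2 * T)" using rate by (simp add: m_def)
      also have "\<dots> \<le> m * rate ^ k"
        using True rate m by (intro mult_left_mono power_decreasing) auto
      finally show ?thesis using M errors_below_mono by blast
    next
      case False
      define h where "h = k - T"
      have h: "k = h + T" "T \<le> h" using False by (auto simp: h_def)
      have window: "errors_below (h + t) (m * rate ^ h)" if "t < T" for t
      proof (rule errors_below_mono)
        show "errors_below (h + t) (m * rate ^ (h + t))" using h that by (intro less.IH) auto
        show "m * rate ^ (h + t) \<le> m * rate ^ h"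
          using rate m by (intro mult_left_mono power_decreasing) auto
      qed
      have m_h: "0 \<le> m * rate ^ h" using rate m by simp
      have pow: "m * rate ^ k = m * rate ^ h * rate ^ T" by (simp add: h power_add)
      obtain k' where k': "k = Suc k'" "T \<le> k'"
        using h T that[of "k - 1"] by simp
      have "norm (x k i - p) \<le> m * rate ^ k" for i
        using dist_rate[of k' "m * rate ^ k'" i] less.IH[of k'] k' rate m by (simp add: mult_ac)
      moreover have "norm (x k i - x k j) \<le> \<sigma> * l * (m * rate ^ k)" for i j
        unfolding pow unfolding h(1) by (rule spread_rate[OF window m_h])
      moreover have "(\<Sum>i\<in>UNIV. norm (resid k i)) \<le> \<tau> * l * (m * rate ^ k)"
        unfolding pow unfolding h(1) by (rule resid_rate[OF window m_h])
      ultimately show ?thesis unfolding errors_below_def by blast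
    qed
  qed
  show thesis by (rule that[of m]) (use bound in \<open>auto simp: errors_below_def\<close>)
qed

end

end

section \<open>From runs of the algorithm to gradient tracking\<close>

text \<open>
  Finitely many exceptions are absorbed by the constant; this discards the first phase and the
  first \<open>T\<close> steps of the second one.
\<close>

lemma geometric_bound_from_tail:
  fixes u :: "nat \<Rightarrow> real"
  assumes "0 < \<rho>" and tail: "\<And>k. N \<le> k \<Longrightarrow> u k \<le> m * \<rho> ^ k"
  obtains c where "0 < c" "\<And>k. u k \<le> c * \<rho> ^ k"
proof -
  define h where "h = (\<Sum>k<N. \<bar>u k\<bar> / \<rho> ^ k)"
  have h: "0 \<le> h" using assms by (auto simp: h_def intro!: sum_nonneg)
  have "u k \<le> (1 + \<bar>m\<bar> + h) * \<rho> ^ k" for k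
  proof (cases "N \<le> k")
    case True
    have "m * \<rho> ^ k \<le> (1 + \<bar>m\<bar> + h) * \<rho> ^ k"
      using assms h by (intro mult_right_mono) auto
    with tail[OF True] show ?thesis by simp
  next
    case False
    then have "\<bar>u k\<bar> / \<rho> ^ k \<le> h"
      unfolding h_def using assms by (intro member_le_sum) auto
    then have "\<bar>u k\<bar> / \<rho> ^ k \<le> 1 + \<bar>m\<bar> + h" by simp
    then have "\<bar>u k\<bar> \<le> (1 + \<bar>m\<bar> + h) * \<rho> ^ k"
      using assms by (simp add: pos_divide_le_eq)
    then show ?thesis by simp
  qed
  moreover have "0 < 1 + \<bar>m\<bar> + h" using h by simp
  ultimately show thesis using that by blast
qed

lemma norm_stacked_diff_le:
  fixes X :: "real^'d^'n"
  assumes "\<And>i. norm (X $ i - p) \<le> d"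
  shows "norm (X - (\<chi> i. p)) \<le> real CARD('n) * d"
proof -
  have "norm (X - (\<chi> i. p)) \<le> (\<Sum>i\<in>UNIV. norm ((X - (\<chi> i. p)) $ i))"
    unfolding norm_vec_def by (intro L2_set_le_sum) auto
  also have "\<dots> \<le> (\<Sum>i\<in>(UNIV :: 'n set). d)" using assms by (intro sum_mono) simp
  finally show ?thesis by simp
qed

lemma scaled_identity_vector: "(s *\<^sub>R mat 1) *v v = s *\<^sub>R (v :: real^'d)"
  by (simp flip: scaleR_matrix_vector_assoc)

lemma row_weights_stochastic:
  assumes "row_weights E \<eta> w" "0 \<le> \<eta>"
  shows "row_stochastic w" "(i, j) \<in> E \<union> Id \<Longrightarrow> \<eta> \<le> w i j"
proof -
  have *: "\<eta> \<le> w i j \<or> w i j = 0" for i j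
    using assms(1) unfolding row_weights_def atLeastAtMost_iff by blast
  then have "0 \<le> w i j" for i j using assms(2) by (metis order_trans order_refl)
  then show "row_stochastic w" using assms by (auto simp: row_weights_def row_stochastic_def)
qed (use assms in \<open>auto simp: row_weights_def in_nbrs_def\<close>)

lemma column_weights_stochastic:
  assumes "column_weights E \<eta> w" "0 \<le> \<eta>"
  shows "column_stochastic w" "(i, j) \<in> E \<union> Id \<Longrightarrow> \<eta> \<le> w i j"
proof -
  have *: "\<eta> \<le> w i j \<or> w i j = 0" for i j
    using assms(1) unfolding column_weights_def atLeastAtMost_iff by blast
  then have "0 \<le> w i j" for i j using assms(2) by (metis order_trans order_refl)
  then show "column_stochastic w" using assms by (auto simp: column_weights_def column_stochastic_def)
qed (use assms in \<open>auto simp: column_weights_def out_nbrs_def\<close>)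

lemma mix_row_weights:
  assumes "row_weights E \<eta> w"
  shows "mix w u i = (\<Sum>j\<in>in_nbrs E i \<union> {i}. w i j *\<^sub>R u j)"
  unfolding mix_def
  by (rule sum.mono_neutral_right) (use assms in \<open>auto simp: row_weights_def\<close>)

lemma mix_column_weights:
  assumes "column_weights E \<eta> w"
  shows "mix w u i = (\<Sum>j\<in>in_nbrs E i \<union> {i}. w i j *\<^sub>R u j)"
  unfolding mix_def
  by (rule sum.mono_neutral_right)
    (use assms in \<open>auto simp: column_weights_def in_nbrs_def out_nbrs_def\<close>)

text \<open>
  Updates sum over the senders of a node, whereas the conditions on \<open>C\<close> and \<open>B\<close> sum over the
  receivers; both are sums over all edges and self loops.
\<close>

lemma neighbour_sum_swap:
  fixes h :: "'n::finite \<Rightarrow> 'n \<Rightarrow> 'a::comm_monoid_add"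
  shows "(\<Sum>i\<in>UNIV. \<Sum>j\<in>in_nbrs E i \<union> {i}. h i j)
    = (\<Sum>j\<in>UNIV. \<Sum>i\<in>out_nbrs E j \<union> {j}. h i j)"
proof -
  have *: "(\<Sum>j\<in>in_nbrs E i \<union> {i}. h i j) = (\<Sum>j\<in>UNIV. if (i, j) \<in> E \<or> i = j then h i j else 0)" for i
    by (subst sum.inter_filter[symmetric]) (auto simp: in_nbrs_def intro!: sum.cong)
  have **: "(\<Sum>i\<in>out_nbrs E j \<union> {j}. h i j) = (\<Sum>i\<in>UNIV. if (i, j) \<in> E \<or> i = j then h i j else 0)" for j
    by (subst sum.inter_filter[symmetric]) (auto simp: out_nbrs_def intro!: sum.cong)
  show ?thesis unfolding * ** by (rule sum.swap)
qed

lemma tracked_sum_step: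
  fixes C B :: "'n::finite \<Rightarrow> 'n \<Rightarrow> real^'d^'d"
  assumes C: "\<And>j. (\<Sum>i\<in>out_nbrs E j \<union> {j}. C i j) = mat 1"
    and B: "\<And>j. (\<Sum>i\<in>out_nbrs E j \<union> {j}. B i j) = mat 1"
  shows "(\<Sum>i\<in>UNIV. \<Sum>j\<in>in_nbrs E i \<union> {i}. C i j *v u j + B i j *v h j)
    = (\<Sum>j\<in>UNIV. u j) + (\<Sum>j\<in>UNIV. h j)"
proof -
  have mv: "(\<Sum>i\<in>I. M i *v v) = (\<Sum>i\<in>I. M i) *v v" for I :: "'n set" and M :: "'n \<Rightarrow> real^'d^'d" and v
    by (induction I rule: infinite_finite_induct) (auto simp: matrix_vector_mult_add_rdistrib)
  show ?thesis
    unfolding neighbour_sum_swap sum.distrib mv C B by simp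
qed

lemma admissible_initial_column_sums:
  assumes "admissible_initial E \<Lambda> R A C B" "\<And>i. (i, i) \<notin> E"
  shows "(\<Sum>i\<in>out_nbrs E j \<union> {j}. C i j) = mat 1" "(\<Sum>i\<in>out_nbrs E j \<union> {j}. B i j) = mat 1"
proof -
  have "j \<notin> out_nbrs E j" using assms(2) by (simp add: out_nbrs_def)
  then show "(\<Sum>i\<in>out_nbrs E j \<union> {j}. C i j) = mat 1" "(\<Sum>i\<in>out_nbrs E j \<union> {j}. B i j) = mat 1"
    using assms(1) by (auto simp: admissible_initial_def)
qed

text \<open>
  Whatever the parameters of the first phase, it hands over a state in which the sum of the \<open>y\<^sub>i\<close>
  equals the sum of the local gradients.
\<close>

lemma run_initial_tracking:
  assumes "admissible E K \<eta> l \<Lambda> R A C B" "is_run E f \<Lambda> R A C B x y" "\<And>i. (i, i) \<notin> E"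
  shows "k \<le> K \<Longrightarrow> (\<Sum>i\<in>UNIV. y k $ i) = (\<Sum>i\<in>UNIV. gradient (f i) (x k $ i))"
proof (induction k)
  case 0
  then show ?case using assms(2) by (simp add: is_run_def)
next
  case (Suc k)
  let ?h = "\<lambda>j. gradient (f j) (x (Suc k) $ j) - gradient (f j) (x k $ j)"
  have "admissible_initial E (\<Lambda> k) (R k) (A k) (C k) (B k)"
    using assms(1) Suc.prems by (auto simp: admissible_def)
  note cols = admissible_initial_column_sums[OF this assms(3)]
  have "(\<Sum>i\<in>UNIV. y (Suc k) $ i)
      = (\<Sum>i\<in>UNIV. \<Sum>j\<in>in_nbrs E i \<union> {i}. C k i j *v (y k $ j) + B k i j *v ?h j)"
    using assms(2) unfolding is_run_def by (intro sum.cong) auto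
  also have "\<dots> = (\<Sum>j\<in>UNIV. y k $ j) + (\<Sum>j\<in>UNIV. ?h j)"
    by (rule tracked_sum_step[OF cols])
  finally show ?case using Suc by (simp add: sum_subtractf)
qed

lemma admissible_final_step:
  fixes x y :: "nat \<Rightarrow> real^'d^'n"
  assumes "admissible E K \<eta> l \<Lambda> R A C B" "is_run E f \<Lambda> R A C B x y" "K \<le> k"
  obtains r a c b where "row_weights E \<eta> r" "row_weights E \<eta> a"
    "column_weights E \<eta> c" "column_weights E \<eta> b"
    "\<And>i. x (Suc k) $ i = mix r (($) (x k)) i - l *\<^sub>R mix a (($) (y k)) i"
    "\<And>i. y (Suc k) $ i = mix c (($) (y k)) i
      + mix b (\<lambda>j. gradient (f j) (x (Suc k) $ j) - gradient (f j) (x k $ j)) i"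
proof -
  have fin: "admissible_final E \<eta> l (\<Lambda> k) (R k) (A k) (C k) (B k)"
    using assms(1,3) by (auto simp: admissible_def)
  then obtain r a c b where w: "row_weights E \<eta> r" "row_weights E \<eta> a"
      "column_weights E \<eta> c" "column_weights E \<eta> b"
    and M: "\<And>i j. R k i j = r i j *\<^sub>R mat 1" "\<And>i j. A k i j = a i j *\<^sub>R mat 1"
      "\<And>i j. C k i j = c i j *\<^sub>R mat 1" "\<And>i j. B k i j = b i j *\<^sub>R mat 1"
      "\<And>i. \<Lambda> k i = l *\<^sub>R mat 1"
    unfolding admissible_final_def by blast
  show thesis
  proof (rule that[OF w])
    fix i
    have "x (Suc k) $ i =
        (\<Sum>j\<in>in_nbrs E i \<union> {i}. R k i j *v (x k $ j) - A k i j *v (\<Lambda> k j *v (y k $ j)))"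
      using assms(2) unfolding is_run_def by blast
    then show "x (Suc k) $ i = mix r (($) (x k)) i - l *\<^sub>R mix a (($) (y k)) i"
      unfolding M scaled_identity_vector mix_row_weights[OF w(1)] mix_row_weights[OF w(2)]
      by (simp add: sum_subtractf scaleR_sum_right mult.commute del: Un_insert_right)
    have "y (Suc k) $ i = (\<Sum>j\<in>in_nbrs E i \<union> {i}. C k i j *v (y k $ j) +
        B k i j *v (gradient (f j) (x (Suc k) $ j) - gradient (f j) (x k $ j)))"
      using assms(2) unfolding is_run_def by blast
    then show "y (Suc k) $ i = mix c (($) (y k)) i
      + mix b (\<lambda>j. gradient (f j) (x (Suc k) $ j) - gradient (f j) (x k $ j)) i"
      unfolding M scaled_identity_vector mix_column_weights[OF w(3)] mix_column_weights[OF w(4)]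
      by (simp add: sum.distrib del: Un_insert_right)
  qed
qed

theorem theorem1:
  fixes E :: "('n::finite \<times> 'n) set"
    and f :: "'n \<Rightarrow> real^'d \<Rightarrow> real"
    and \<beta> :: "'n \<Rightarrow> real"
    and \<alpha>\<^sub>F \<eta> :: real
    and xstar :: "real^'d"
    and K :: nat
  assumes "CARD('n) \<ge> 2"
    and "\<And>i. (i, i) \<notin> E"
    and "strongly_connected E"
    and "\<And>i x. f i differentiable (at x)"
    and "\<And>i. convex_on UNIV (f i)"
    and "\<And>i. smooth (\<beta> i) (f i)"
    and "strongly_convex \<alpha>\<^sub>F (\<lambda>x. \<Sum>i\<in>UNIV. f i x)"
    and "is_arg_min (\<lambda>x. \<Sum>i\<in>UNIV. f i x) (\<lambda>x. True) xstar"
    and "K \<ge> 1"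
    and "0 < \<eta>" and "\<eta> < 1" and "feasible E \<eta>"
  shows "\<exists>lbar>0. \<forall>l. 0 < l \<and> l < lbar \<longrightarrow>
           (\<forall>\<Lambda> R A C B x y.
              admissible E K \<eta> l \<Lambda> R A C B \<and> is_run E f \<Lambda> R A C B x y \<longrightarrow>
              (\<exists>c>0. \<exists>\<rho>. 0 < \<rho> \<and> \<rho> < 1 \<and>
                 (\<forall>k. norm (x k - (\<chi> i. xstar)) \<le> c * \<rho> ^ k)))"
proof -
  let ?F = "\<lambda>x. \<Sum>i\<in>UNIV. f i x"
  have \<beta>: "0 < \<beta> i" for i using assms(6) by (simp add: smooth_def)
  have \<alpha>: "0 < \<alpha>\<^sub>F" using assms(7) by (simp add: strongly_convex_def)
  have grad_F: "gradient ?F u = (\<Sum>i\<in>UNIV. gradient (f i) u)" for u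
    by (rule gradient_sum) (rule assms(4))
  have stationary: "(\<Sum>i\<in>UNIV. gradient (f i) xstar) = 0"
    using gradient_arg_min[OF _ assms(8)] assms(7) unfolding grad_F
    by (simp add: strongly_convex_def)
  obtain T where T: "1 \<le> T" "\<And>i j. (i, j) \<in> (E \<union> Id) ^^ T"
    using strongly_connected_uniform_walk_length[OF assms(3)] by blast
  define \<epsilon> where "\<epsilon> = \<eta> ^ T"
  have \<epsilon>: "0 < \<epsilon>" "\<epsilon> \<le> 1" using assms(10,11) by (auto simp: \<epsilon>_def intro!: power_le_one)
  define L where "L = (\<Sum>i\<in>UNIV. \<beta> i)"
  have L: "0 < L" unfolding L_def using \<beta> by (intro sum_pos) auto
  let ?\<sigma> = "spread_gain L \<epsilon> T" and ?\<tau> = "resid_gain L \<epsilon> T"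
  have gains: "0 < ?\<sigma>" "0 < ?\<tau>" "0 < L * ?\<sigma> + ?\<tau>"
    using spread_gain_pos[OF L \<epsilon>(1) T(1)] resid_gain_pos[OF L \<epsilon>(1) T(1)] L
    by (auto intro: add_pos_pos)
  \<comment> \<open>one entry for each smallness condition of \<open>linear_convergence\<close>\<close>
  define lbar where "lbar = Min {\<alpha>\<^sub>F / L\<^sup>2, 2 / (real T * \<alpha>\<^sub>F), 1 / ?\<tau>,
    \<epsilon> * \<alpha>\<^sub>F / 4 / (L * ?\<sigma> + ?\<tau>)}"
  have "0 < lbar"
    unfolding lbar_def using \<alpha> L T(1) gains \<epsilon>(1) by (auto intro!: divide_pos_pos)
  moreover have "\<exists>c>0. \<exists>\<rho>. 0 < \<rho> \<and> \<rho> < 1 \<and> (\<forall>k. norm (x k - (\<chi> i. xstar)) \<le> c * \<rho> ^ k)"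
    if l: "0 < l" "l < lbar" and adm: "admissible E K \<eta> l \<Lambda> R A C B"
      and run: "is_run E f \<Lambda> R A C B x y" for l \<Lambda> R A C B x y
  proof -
    have "l \<le> \<alpha>\<^sub>F / L\<^sup>2" "l \<le> 2 / (real T * \<alpha>\<^sub>F)" "l \<le> 1 / ?\<tau>"
      "l \<le> \<epsilon> * \<alpha>\<^sub>F / 4 / (L * ?\<sigma> + ?\<tau>)"
      using l(2) unfolding lbar_def by auto
    moreover have "0 < L\<^sup>2" "0 < real T * \<alpha>\<^sub>F" using L T(1) \<alpha> by auto
    ultimately have "l * L\<^sup>2 \<le> \<alpha>\<^sub>F" "l * (real T * \<alpha>\<^sub>F) \<le> 2" "l * ?\<tau> \<le> 1"
        "l * (L * ?\<sigma> + ?\<tau>) \<le> \<epsilon> * \<alpha>\<^sub>F / 4"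
      using gains by (blast intro: pos_le_divide_eq[THEN iffD1])+
    then have small: "l * L\<^sup>2 \<le> \<alpha>\<^sub>F" "real T * (l * \<alpha>\<^sub>F) \<le> 2" "?\<tau> * l \<le> 1"
        "l * (L * ?\<sigma> + ?\<tau>) \<le> \<epsilon> * \<alpha>\<^sub>F / 4"
      by (simp_all only: mult.commute[of ?\<tau> l] mult.left_commute[of "real T" l])
    \<comment> \<open>an opaque name for the step relation, so that the weights can be chosen as functions of time\<close>
    define step where "step t r a c b \<longleftrightarrow> row_weights E \<eta> r \<and> row_weights E \<eta> a \<and>
        column_weights E \<eta> c \<and> column_weights E \<eta> b \<and>
        (\<forall>i. x (Suc (K + t)) $ i
          = mix r (($) (x (K + t))) i - l *\<^sub>R mix a (($) (y (K + t))) i) \<and>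
        (\<forall>i. y (Suc (K + t)) $ i = mix c (($) (y (K + t))) i
          + mix b (\<lambda>j. gradient (f j) (x (Suc (K + t)) $ j) - gradient (f j) (x (K + t) $ j)) i)"
      for t r a c b
    have "\<exists>r a c b. step t r a c b" for t
      unfolding step_def by (rule admissible_final_step[OF adm run le_add1[of K t]]) blast
    then obtain r a c b where "\<And>t. step t (r t) (a t) (c t) (b t)" by metis
    then have
      w: "\<And>t. row_weights E \<eta> (r t)" "\<And>t. row_weights E \<eta> (a t)"
        "\<And>t. column_weights E \<eta> (c t)" "\<And>t. column_weights E \<eta> (b t)"
      and steps: "\<And>t i. x (Suc (K + t)) $ i
          = mix (r t) (($) (x (K + t))) i - l *\<^sub>R mix (a t) (($) (y (K + t))) i"
        "\<And>t i. y (Suc (K + t)) $ i = mix (c t) (($) (y (K + t))) i + mix (b t)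
            (\<lambda>j. gradient (f j) (x (Suc (K + t)) $ j) - gradient (f j) (x (K + t) $ j)) i"
      unfolding step_def by blast+
    have \<eta>: "0 \<le> \<eta>" using assms(10) by simp
    interpret gradient_tracking r a c b "\<lambda>i. gradient (f i)" \<beta> \<alpha>\<^sub>F L \<epsilon> l T xstar
      "\<lambda>t. ($) (x (K + t))" "\<lambda>t. ($) (y (K + t))"
    proof
      show "\<epsilon> \<le> weight_product (\<lambda>t. r (k + t)) T i j" for k i j
        unfolding \<epsilon>_def
        by (rule weight_product_walk_ge[OF \<eta> _ _ T(2)])
          (use row_weights_stochastic[OF w(1) \<eta>] in \<open>auto simp: row_stochastic_def\<close>)
      show "\<epsilon> \<le> weight_product (\<lambda>t. c (k + t)) T i j" for k i j
        unfolding \<epsilon>_def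
        by (rule weight_product_walk_ge[OF \<eta> _ _ T(2)])
          (use column_weights_stochastic[OF w(3) \<eta>] in \<open>auto simp: column_stochastic_def\<close>)
      show "\<alpha>\<^sub>F * (norm (u - v))\<^sup>2 \<le> ((\<Sum>i\<in>UNIV. gradient (f i) u)
          - (\<Sum>i\<in>UNIV. gradient (f i) v)) \<bullet> (u - v)" for u v
        using assms(7) unfolding strongly_convex_def grad_F by simp
      show "(\<Sum>i\<in>UNIV. y (K + 0) $ i) = (\<Sum>i\<in>UNIV. gradient (f i) (x (K + 0) $ i))"
        using run_initial_tracking[OF adm run assms(2), of K] by simp
      show "x (K + Suc k) $ i = mix (r k) (($) (x (K + k))) i - l *\<^sub>R mix (a k) (($) (y (K + k))) i"
        for k i
        unfolding add_Suc_right by (rule steps)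
      show "y (K + Suc k) $ i = mix (c k) (($) (y (K + k))) i + mix (b k)
          (\<lambda>j. gradient (f j) (x (K + Suc k) $ j) - gradient (f j) (x (K + k) $ j)) i" for k i
        unfolding add_Suc_right by (rule steps)
    qed (use T(1) \<epsilon> \<alpha> \<beta> l(1) stationary assms(6) row_weights_stochastic(1)[OF w(1) \<eta>]
        row_weights_stochastic(1)[OF w(2) \<eta>] column_weights_stochastic(1)[OF w(3) \<eta>]
        column_weights_stochastic(1)[OF w(4) \<eta>] in \<open>auto simp: L_def smooth_def\<close>)
    obtain m where m: "\<And>t i. T \<le> t \<Longrightarrow> norm (x (K + t) $ i - xstar) \<le> m * rate ^ t"
      using linear_convergence[OF small] by blast
    note rate = rate[OF small]
    have tail: "norm (x k - (\<chi> i. xstar)) \<le> (real CARD('n) * m / rate ^ K) * rate ^ k"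
      if "K + T \<le> k" for k
    proof -
      have "k = K + (k - K)" "T \<le> k - K" using that by auto
      then have "norm (x k - (\<chi> i. xstar)) \<le> real CARD('n) * (m * rate ^ (k - K))"
        using m[of "k - K"] by (intro norm_stacked_diff_le) metis
      also have "rate ^ (k - K) = rate ^ k / rate ^ K"
        using rate that by (simp add: power_diff)
      finally show ?thesis by simp
    qed
    obtain C where "0 < C" "\<And>k. norm (x k - (\<chi> i. xstar)) \<le> C * rate ^ k"
      using geometric_bound_from_tail[OF rate(1) tail] by blast
    with rate show ?thesis by blast
  qed
  ultimately show ?thesis by blast
qed

end
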